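(* Let $T$ be a leafless tree such that $\partial T$ is a Cantor set, and let a group $\Gamma$ act on $T$ by automorphisms. The following are equivalent. (1) The action of $\Gamma$ on $\partial T$ is extremely proximal. (2) The action of $[\![\Gamma]\!]$ on $\partial T$ is extremely proximal. (3) The action of $\Gamma$ on $\partial T$ is minimal and $\partial T$ does not support any $\Gamma$-invariant (Borel) probability measure. (4) The action of $\Gamma$ on $T$ is minimal and not parabolic, that is, there is no proper $\Gamma$-invariant subtree of $T$ and $\Gamma$ has no fixed point in $\partial T$.
   Context: Trees are (nonempty) connected graphs without cycles; a leaf is a vertex of valency one. A path is a finite or infinite sequence of consecutively adjacent vertices without backtracks (vertices with indices differing by two are distinct); a ray is a path indexed by $\mathbf N$. Ends of $T$ are classes of rays, two rays being equivalent if they coincide after deleting finite (not necessarily equinumerous) initial parts. The set of ends is the boundary $\partial T$. For an oriented edge $\vec e=(v,w)$, $\partial T_{\vec e}\subset\partial T$ is the set of classes of rays starting with $v,w$. The topology of $\partial T$ has the sets $\partial T_{\vec e}$ as a basis. For a group $\Gamma$ acting by homeomorphisms on a Cantor set $C$, the topological full group is $$[\![\Gamma]\!]=\{g\in\mathrm{Homeo}(C): \text{for each }x\in C\text{ there exist a neighbourhood }U\text{ of }x\text{ and }\gamma\in\Gamma\text{ such that }g|_U=\gamma|_U\}.$$ Here $C=\partial T$ with the induced action of $\Gamma$. An action of a group $G$ on a Cantor set $C$ is extremely proximal if for any nonempty and proper clopen sets $V_1,V_2\subsetneq C$ there exists $g\in G$ such that $g(V_2)\subsetneq V_1$. An action by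 homeomorphisms on a topological space is minimal if there is no proper nonempty closed invariant subset. *)

theory Defs
  imports "HOL-Probability.Probability" "HOL-Algebra.Group_Action"
begin

section \<open>Trees\<close>

text \<open>A simple graph has a vertex set \<open>V\<close> and a set \<open>E\<close> of oriented edges; each geometric
  edge contributes both of its orientations. No finiteness is assumed.\<close>

definition simple_graph :: "'v set \<Rightarrow> ('v \<times> 'v) set \<Rightarrow> bool" where
  "simple_graph V E \<longleftrightarrow> E \<subseteq> V \<times> V \<and> sym E \<and> irrefl E"

definition graph_cycle :: "('v \<times> 'v) set \<Rightarrow> 'v list \<Rightarrow> bool" where
  "graph_cycle E p \<longleftrightarrow> length p \<ge> 3 \<and> distinct p \<and>
     successively (\<lambda>v w. (v, w) \<in> E) p \<and> (last p, hd p) \<in> E"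

definition is_tree :: "'v set \<Rightarrow> ('v \<times> 'v) set \<Rightarrow> bool" where
  "is_tree V E \<longleftrightarrow> simple_graph V E \<and> V \<noteq> {} \<and>
     (\<forall>v\<in>V. \<forall>w\<in>V. (v, w) \<in> E\<^sup>*) \<and> (\<nexists>p. graph_cycle E p)"

definition leaf :: "'v set \<Rightarrow> ('v \<times> 'v) set \<Rightarrow> 'v \<Rightarrow> bool" where
  "leaf V E v \<longleftrightarrow> v \<in> V \<and> card {w. (v, w) \<in> E} = 1"

definition leafless :: "'v set \<Rightarrow> ('v \<times> 'v) set \<Rightarrow> bool" where
  "leafless V E \<longleftrightarrow> (\<nexists>v. leaf V E v)"

definition subtree :: "'v set \<Rightarrow> ('v \<times> 'v) set \<Rightarrow> 'v set \<Rightarrow> ('v \<times> 'v) set \<Rightarrow> bool" where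
  "subtree V' E' V E \<longleftrightarrow> is_tree V' E' \<and> V' \<subseteq> V \<and> E' \<subseteq> E"

section \<open>The boundary of a tree\<close>

definition ray :: "('v \<times> 'v) set \<Rightarrow> (nat \<Rightarrow> 'v) \<Rightarrow> bool" where
  "ray E r \<longleftrightarrow> (\<forall>n. (r n, r (n + 1)) \<in> E) \<and> (\<forall>n. r n \<noteq> r (n + 2))"

definition ray_equiv :: "('v \<times> 'v) set \<Rightarrow> ((nat \<Rightarrow> 'v) \<times> (nat \<Rightarrow> 'v)) set" where
  "ray_equiv E = {(r, s). ray E r \<and> ray E s \<and> (\<exists>m n. \<forall>k. r (m + k) = s (n + k))}"

definition ends :: "('v \<times> 'v) set \<Rightarrow> (nat \<Rightarrow> 'v) set set" where
  "ends E = {r. ray E r} // ray_equiv E"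

definition ends_through :: "('v \<times> 'v) set \<Rightarrow> 'v \<times> 'v \<Rightarrow> (nat \<Rightarrow> 'v) set set" where
  "ends_through E e = {\<omega> \<in> ends E. \<exists>r\<in>\<omega>. r 0 = fst e \<and> r 1 = snd e}"

text \<open>The generating family is a basis, not just a subbasis, and the underlying set of the
  topology is the whole boundary; see \<open>boundary_topology_base\<close> and
  \<open>topspace_boundary_topology\<close> below.\<close>

definition boundary_topology :: "('v \<times> 'v) set \<Rightarrow> (nat \<Rightarrow> 'v) set topology" where
  "boundary_topology E = topology_generated_by (ends_through E ` E)"

lemma equiv_ray_equiv: "equiv {r. ray E r} (ray_equiv E)"
proof (rule equivI)
  show "ray_equiv E \<subseteq> {r. ray E r} \<times> {r. ray E r}"
    by (auto simp: ray_equiv_def)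
  show "refl_on {r. ray E r} (ray_equiv E)"
    by (auto simp: refl_on_def ray_equiv_def)
  show "sym (ray_equiv E)"
    unfolding sym_def ray_equiv_def by clarsimp (metis (no_types))
  show "trans (ray_equiv E)"
  proof (rule transI)
    fix r s t assume "(r, s) \<in> ray_equiv E" "(s, t) \<in> ray_equiv E"
    then obtain m n p q where *: "ray E r" "ray E t"
      and rs: "\<And>k. r (m + k) = s (n + k)" and st: "\<And>k. s (p + k) = t (q + k)"
      unfolding ray_equiv_def by auto
    have "r ((m + p) + k) = t ((q + n) + k)" for k
      using rs[of "p + k"] st[of "n + k"] by (simp add: ac_simps)
    then show "(r, t) \<in> ray_equiv E"
      using * unfolding ray_equiv_def by blast
  qed
qed

lemma end_ray: "\<omega> \<in> ends E \<Longrightarrow> r \<in> \<omega> \<Longrightarrow> ray E r"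
  by (auto simp: ends_def quotient_def ray_equiv_def)

lemma end_equiv: "\<omega> \<in> ends E \<Longrightarrow> r \<in> \<omega> \<Longrightarrow> (r, s) \<in> ray_equiv E \<longleftrightarrow> s \<in> \<omega>"
  unfolding ends_def
  using in_quotient_imp_closed[OF equiv_ray_equiv, of \<omega> E r s]
    quotient_eq_iff[OF equiv_ray_equiv, of \<omega> E \<omega> r s] by blast

lemma end_nonempty: "\<omega> \<in> ends E \<Longrightarrow> \<exists>r. r \<in> \<omega>"
  unfolding ends_def using in_quotient_imp_non_empty[OF equiv_ray_equiv] by blast

lemma ends_through_mono:
  assumes r: "ray E r"
  shows "ends_through E (r m, r (m + 1)) \<subseteq> ends_through E (r 0, r 1)"
proof
  fix \<omega> assume "\<omega> \<in> ends_through E (r m, r (m + 1))"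
  then obtain t where w: "\<omega> \<in> ends E" and t: "t \<in> \<omega>" "t 0 = r m" "t 1 = r (m + 1)"
    unfolding ends_through_def by auto
  have rt: "ray E t" using end_ray[OF w t(1)] .
  define u where "u n = (if n \<le> m then r n else t (n - m))" for n
  have u_le: "u n = r n" if "n \<le> m + 1" for n
    using that t by (cases "n = m + 1") (auto simp: u_def)
  have u_ge: "u n = t (n - m)" if "n \<ge> m" for n
    using that t by (auto simp: u_def)
  have "ray E u"
    unfolding ray_def
  proof (intro conjI allI)
    fix n
    show "(u n, u (n + 1)) \<in> E"
    proof (cases "n \<le> m")
      case True
      then show ?thesis using r by (simp add: u_le ray_def)
    next
      case False
      then show ?thesis using rt by (simp add: u_ge ray_def Suc_diff_le)
    qed
    show "u n \<noteq> u (n + 2)"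
    proof (cases "n + 1 \<le> m")
      case True
      then show ?thesis using r by (simp add: u_le ray_def)
    next
      case False
      then have "n + 2 - m = (n - m) + 2" by simp
      then show ?thesis using rt False by (simp add: u_ge ray_def)
    qed
  qed
  moreover have "\<forall>k. t (0 + k) = u (m + k)"
    by (simp add: u_ge)
  ultimately have "(t, u) \<in> ray_equiv E"
    using rt unfolding ray_equiv_def by blast
  then have "u \<in> \<omega>" using end_equiv[OF w t(1)] by simp
  moreover have "u 0 = r 0" "u 1 = r 1" using u_le by simp_all
  ultimately show "\<omega> \<in> ends_through E (r 0, r 1)"
    using w unfolding ends_through_def by auto
qed

lemma Union_ends_through: "(\<Union>e\<in>E. ends_through E e) = ends E"
proof
  show "(\<Union>e\<in>E. ends_through E e) \<subseteq> ends E"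
    by (auto simp: ends_through_def)
  show "ends E \<subseteq> (\<Union>e\<in>E. ends_through E e)"
  proof
    fix \<omega> assume w: "\<omega> \<in> ends E"
    then obtain r where r: "r \<in> \<omega>" using end_nonempty by blast
    have "(r 0, r 1) \<in> E" using end_ray[OF w r] by (auto simp: ray_def dest: spec[of _ 0])
    then show "\<omega> \<in> (\<Union>e\<in>E. ends_through E e)"
      using w r unfolding ends_through_def by force
  qed
qed

lemma topspace_boundary_topology: "topspace (boundary_topology E) = ends E"
  by (simp add: boundary_topology_def topology_generated_by_topspace Union_ends_through)

lemma boundary_topology_base:
  "openin (boundary_topology E) U \<longleftrightarrow>
     U \<subseteq> ends E \<and> (\<forall>\<omega>\<in>U. \<exists>e\<in>E. \<omega> \<in> ends_through E e \<and> ends_through E e \<subseteq> U)"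
  (is "_ \<longleftrightarrow> ?P U")
proof
  assume "openin (boundary_topology E) U"
  then have "generate_topology_on (ends_through E ` E) U"
    by (simp add: boundary_topology_def openin_topology_generated_by_iff)
  then show "?P U"
  proof induction
    case Empty
    then show ?case by simp
  next
    case (Int A B)
    have "\<exists>e\<in>E. \<omega> \<in> ends_through E e \<and> ends_through E e \<subseteq> A \<inter> B" if "\<omega> \<in> A \<inter> B" for \<omega>
    proof -
      have wA: "\<omega> \<in> A" and wB: "\<omega> \<in> B" using that by simp_all
      obtain a where a: "\<omega> \<in> ends_through E a" "ends_through E a \<subseteq> A"
        using bspec[OF conjunct2[OF Int.IH(1)] wA] by blast
      obtain b where b: "\<omega> \<in> ends_through E b" "ends_through E b \<subseteq> B"
        using bspec[OF conjunct2[OF Int.IH(2)] wB] by blast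
      then obtain r s where w: "\<omega> \<in> ends E" and r: "r \<in> \<omega>" "(r 0, r 1) = a"
          and s: "s \<in> \<omega>" "(s 0, s 1) = b"
        using a(1) b(1) unfolding ends_through_def by force
      have ray_r: "ray E r" and ray_s: "ray E s" using end_ray[OF w] r(1) s(1) by simp_all
      have "(r, s) \<in> ray_equiv E" using end_equiv[OF w r(1)] s(1) by simp
      then obtain m n where mn: "\<And>k. r (m + k) = s (n + k)"
        unfolding ray_equiv_def by auto
      let ?e = "(r m, r (m + 1))"
      have e': "?e = (s n, s (n + 1))" using mn[of 0] mn[of 1] by simp
      have 1: "ends_through E ?e \<subseteq> A"
        using ends_through_mono[OF ray_r, of m] r a by simp
      have 2: "ends_through E ?e \<subseteq> B"
        using ends_through_mono[OF ray_s, of n] s b unfolding e' by simp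
      define t where "t k = r (m + k)" for k
      have ray_t: "ray E t" using ray_r by (simp add: ray_def t_def)
      have "\<forall>k. r (m + k) = t (0 + k)" by (simp add: t_def)
      then have "(r, t) \<in> ray_equiv E" using ray_r ray_t unfolding ray_equiv_def by blast
      then have "t \<in> \<omega>" using end_equiv[OF w r(1)] by simp
      then have "\<omega> \<in> ends_through E ?e" using w unfolding ends_through_def by (auto simp: t_def intro!: bexI[of _ t])
      moreover have "?e \<in> E" using ray_r by (simp add: ray_def)
      ultimately show ?thesis using 1 2 by blast
    qed
    moreover have "A \<inter> B \<subseteq> ends E" using Int.IH(1) by (simp add: le_infI1)
    ultimately show ?case by (simp only: Ball_def) simp
  next
    case (UN K)
    
    have "\<Union>K \<subseteq> ends E" using UN.IH by (simp add: Union_least)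
    moreover have "\<exists>e\<in>E. \<omega> \<in> ends_through E e \<and> ends_through E e \<subseteq> \<Union>K"
      if w: "\<omega> \<in> \<Union>K" for \<omega>
    proof -
      obtain k where k: "k \<in> K" "\<omega> \<in> k" using w by (rule UnionE)
      obtain e where "e \<in> E" "\<omega> \<in> ends_through E e" "ends_through E e \<subseteq> k"
        using bspec[OF conjunct2[OF UN.IH[OF k(1)]] k(2)] by (elim bexE conjE)
      with k(1) show ?thesis by (meson Union_upper subset_trans)
    qed
    ultimately show ?case by simp
  next
    case (Basis s)
    then show ?case by (auto simp: ends_through_def)
  qed
next
  assume P: "?P U"
  let ?B = "{B \<in> ends_through E ` E. B \<subseteq> U}"
  have "U = \<Union>?B"
  proof
    show "U \<subseteq> \<Union>?B"
    proof
      fix \<omega> assume "\<omega> \<in> U"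
      with P obtain e where "e \<in> E" "\<omega> \<in> ends_through E e" "ends_through E e \<subseteq> U"
        by (elim conjE) (drule (1) bspec, elim bexE conjE)
      then show "\<omega> \<in> \<Union>?B" by (intro UnionI[of "ends_through E e"]) simp_all
    qed
  qed (rule Union_least, simp)
  moreover have "openin (boundary_topology E) (\<Union>?B)"
    unfolding boundary_topology_def by (intro openin_Union) (auto intro: topology_generated_by_Basis)
  ultimately show "openin (boundary_topology E) U" by simp
qed

section \<open>Group actions\<close>

text \<open>Actions on a set are the library's homomorphisms into the group of bijections,
  locale \<open>group_action\<close>.\<close>

definition tree_action ::
    "('g, 'm) monoid_scheme \<Rightarrow> 'v set \<Rightarrow> ('v \<times> 'v) set \<Rightarrow> ('g \<Rightarrow> 'v \<Rightarrow> 'v) \<Rightarrow> bool" where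
  "tree_action G V E \<phi> \<longleftrightarrow> group_action G V \<phi> \<and>
     (\<forall>g\<in>carrier G. \<forall>v\<in>V. \<forall>w\<in>V. (v, w) \<in> E \<longleftrightarrow> (\<phi> g v, \<phi> g w) \<in> E)"

text \<open>An end is a set of rays, so a group element acts on it by taking images; the map is made
  extensional, as are all elements of the library's \<open>Bij\<close>.\<close>

definition boundary_action ::
    "('v \<times> 'v) set \<Rightarrow> ('g \<Rightarrow> 'v \<Rightarrow> 'v) \<Rightarrow> 'g \<Rightarrow> (nat \<Rightarrow> 'v) set \<Rightarrow> (nat \<Rightarrow> 'v) set" where
  "boundary_action E \<phi> g = (\<lambda>\<omega>\<in>ends E. (\<lambda>r. \<phi> g \<circ> r) ` \<omega>)"

definition cantor_space :: "'c topology \<Rightarrow> bool" where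
  "cantor_space X \<longleftrightarrow>
     X homeomorphic_space product_topology (\<lambda>_::nat. discrete_topology (UNIV :: bool set)) UNIV"

text \<open>The topological full group is a subgroup of the group of bijections of the space; it acts
  on the space tautologically, that is by \<open>\<lambda>h. h\<close>.\<close>

definition topological_full_group ::
    "('g, 'm) monoid_scheme \<Rightarrow> 'c topology \<Rightarrow> ('g \<Rightarrow> 'c \<Rightarrow> 'c) \<Rightarrow> ('c \<Rightarrow> 'c) monoid" where
  "topological_full_group G X \<alpha> = BijGroup (topspace X)
     \<lparr>carrier := {h \<in> Bij (topspace X). homeomorphic_map X X h \<and>
        (\<forall>x\<in>topspace X. \<exists>U. openin X U \<and> x \<in> U \<and> (\<exists>\<gamma>\<in>carrier G. \<forall>y\<in>U. h y = \<alpha> \<gamma> y))}\<rparr>"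

definition extremely_proximal ::
    "('g, 'm) monoid_scheme \<Rightarrow> 'c topology \<Rightarrow> ('g \<Rightarrow> 'c \<Rightarrow> 'c) \<Rightarrow> bool" where
  "extremely_proximal G X \<alpha> \<longleftrightarrow>
     (\<forall>V1 V2. openin X V1 \<and> closedin X V1 \<and> V1 \<noteq> {} \<and> V1 \<subset> topspace X \<and>
              openin X V2 \<and> closedin X V2 \<and> V2 \<noteq> {} \<and> V2 \<subset> topspace X
        \<longrightarrow> (\<exists>g\<in>carrier G. \<alpha> g ` V2 \<subset> V1))"

definition minimal_action ::
    "('g, 'm) monoid_scheme \<Rightarrow> 'c topology \<Rightarrow> ('g \<Rightarrow> 'c \<Rightarrow> 'c) \<Rightarrow> bool" where
  "minimal_action G X \<alpha> \<longleftrightarrow>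
     (\<nexists>F. closedin X F \<and> F \<noteq> {} \<and> F \<subset> topspace X \<and> (\<forall>g\<in>carrier G. \<alpha> g ` F = F))"

definition invariant_borel_probability ::
    "('g, 'm) monoid_scheme \<Rightarrow> 'c topology \<Rightarrow> ('g \<Rightarrow> 'c \<Rightarrow> 'c) \<Rightarrow> 'c measure \<Rightarrow> bool" where
  "invariant_borel_probability G X \<alpha> M \<longleftrightarrow> prob_space M \<and>
     space M = topspace X \<and> sets M = sigma_sets (topspace X) {U. openin X U} \<and>
     (\<forall>g\<in>carrier G. distr M M (\<alpha> g) = M)"

definition minimal_tree_action ::
    "('g, 'm) monoid_scheme \<Rightarrow> 'v set \<Rightarrow> ('v \<times> 'v) set \<Rightarrow> ('g \<Rightarrow> 'v \<Rightarrow> 'v) \<Rightarrow> bool" where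
  "minimal_tree_action G V E \<phi> \<longleftrightarrow>
     (\<nexists>V' E'. subtree V' E' V E \<and> (V', E') \<noteq> (V, E) \<and>
        (\<forall>g\<in>carrier G. \<phi> g ` V' = V' \<and> map_prod (\<phi> g) (\<phi> g) ` E' = E'))"

definition parabolic ::
    "('g, 'm) monoid_scheme \<Rightarrow> ('v \<times> 'v) set \<Rightarrow> ('g \<Rightarrow> 'v \<Rightarrow> 'v) \<Rightarrow> bool" where
  "parabolic G E \<phi> \<longleftrightarrow> (\<exists>\<omega>\<in>ends E. \<forall>g\<in>carrier G. boundary_action E \<phi> g \<omega> = \<omega>)"

end

theory Submission
  imports Defs
begin

text \<open>
  We go around the cycle (1), (2), (3), (4), (1). An invariant measure is preserved on clopen sets by
  the topological full group, so for three disjoint clopen sets covering the boundary, extreme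
  proximality bounds the measure of the union of any two of them by that of the third, which is absurd.

  If the boundary action is minimal and there is a proper invariant subtree, the ends behind the
  edges leaving the subtree form a nonempty invariant open set, hence everything; by compactness
  there are finitely many such edges. Thus some finite vertex set is invariant, and so are its balls.
  The clopen partitions which they define are permuted transitively, and the uniform weights on their
  atoms extend to an invariant measure.

  For the last implication, minimality lets any vertex be moved into any half-tree. If some half-tree
  could not be made disjoint from itself, its pairwise intersecting translates would point from every
  vertex towards one common fixed end. Hence every half-tree can be moved into its own complement,
  and therefore into every half-tree.
\<close>

section \<open>Extremely proximal actions\<close>

text \<open>No local finiteness is assumed: it comes from compactness, because the edges at a vertex
  split the boundary into disjoint nonempty open sets. This makes the balls around a finite
  invariant vertex set finite, and with them the partitions of the boundary. The uniform weights of
  successive partitions are compatible because transitivity on the atoms of one level forces each of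
  them to contain equally many atoms of the next level. Countable additivity costs nothing in a
  compact space: a decreasing sequence of clopen sets with empty intersection is eventually empty.
  Trees enter through half-trees, the sides of a deleted edge, rather than through distances or
  projections. A step can leave a half-tree only across its own edge, and this single fact yields
  the nesting of half-trees. Minimality alone cannot aim one half-tree at another: an edge moved
  into the target carries one of its two sides inside, possibly the wrong one, and moving the
  half-tree into its complement beforehand corrects this.\<close>

lemma Union_finite_induct:
  assumes "finite \<F>" and "P {}" and "\<And>A. A \<in> \<F> \<Longrightarrow> P A" and "\<And>A B. P A \<Longrightarrow> P B \<Longrightarrow> P (A \<union> B)"
  shows "P (\<Union>\<F>)"
  using assms(1,3) by (induction \<F>) (auto simp: assms(2,4))

text \<open>Being closed in a compact space, \<open>A\<close> is compact, so finitely many open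
  subsets of \<open>A\<close> with property \<open>P\<close> have union exactly \<open>A\<close>.
  The rule turns local information at each point into a statement about the whole clopen
  set.\<close>

lemma compact_clopen_induct [consumes 3, case_names empty Un basic]:
  assumes X: "compact_space X" and A: "openin X A" "closedin X A"
    and P0: "P {}" and PU: "\<And>B C. P B \<Longrightarrow> P C \<Longrightarrow> P (B \<union> C)"
    and basic: "\<And>x. x \<in> A \<Longrightarrow> \<exists>B. openin X B \<and> x \<in> B \<and> B \<subseteq> A \<and> P B"
  shows "P A"
proof -
  let ?\<U> = "{B. openin X B \<and> B \<subseteq> A \<and> P B}"
  have "compactin X A" using X A(2) by (rule closedin_compact_space)
  moreover have "A \<subseteq> \<Union>?\<U>" using basic by blast
  ultimately obtain \<F> where F: "finite \<F>" "\<F> \<subseteq> ?\<U>" "A \<subseteq> \<Union>\<F>"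
    using compactinD[of X A ?\<U>] by auto
  then have "A = \<Union>\<F>" by auto
  moreover have "P (\<Union>\<F>)"
    using F(1) P0 by (rule Union_finite_induct) (use F(2) PU in auto)
  ultimately show ?thesis by simp
qed

text \<open>A finite subcover cannot omit a member, since the points of a nonempty member lie in no
  other one. This gives finite valency and the finiteness of the set of edges leaving an invariant
  subtree.\<close>

lemma finite_disjoint_open_cover:
  assumes X: "compact_space X"
    and U: "\<And>i. i \<in> I \<Longrightarrow> openin X (U i)" "\<And>i. i \<in> I \<Longrightarrow> U i \<noteq> {}"
    and disj: "disjoint_family_on U I" and cover: "topspace X \<subseteq> (\<Union>i\<in>I. U i)"
  shows "finite I"
proof -
  obtain J where J: "finite J" "J \<subseteq> I" "topspace X \<subseteq> (\<Union>i\<in>J. U i)"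
  proof -
    have "\<exists>\<F>. finite \<F> \<and> \<F> \<subseteq> U ` I \<and> topspace X \<subseteq> \<Union>\<F>"
      by (rule compactinD[OF X[unfolded compact_space_def]]) (use U(1) cover in auto)
    then show ?thesis using that by (auto simp: ex_finite_subset_image)
  qed
  have "i \<in> J" if i: "i \<in> I" for i
  proof -
    obtain x where "x \<in> U i" using U(2) i by blast
    then have "x \<in> topspace X" using U(1)[OF i] openin_subset by blast
    then obtain j where "j \<in> J" "x \<in> U j" using J by blast
    moreover have "i \<noteq> j \<Longrightarrow> U i \<inter> U j = {}"
      using disjoint_family_onD[OF disj i] J(2) \<open>j \<in> J\<close> by blast
    ultimately show ?thesis using \<open>x \<in> U i\<close> by blast
  qed
  then show ?thesis using finite_subset[OF _ J(1)] by blast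
qed

section \<open>Actions by homeomorphisms and their topological full groups\<close>

locale continuous_action = group_action G "topspace X" \<alpha>
  for G :: "('g, 'm) monoid_scheme" (structure) and X :: "'c topology" and \<alpha> :: "'g \<Rightarrow> 'c \<Rightarrow> 'c" +
  assumes homeo: "g \<in> carrier G \<Longrightarrow> homeomorphic_map X X (\<alpha> g)"
begin

lemma group_G: "group G"
  using group_hom group_hom.axioms(1) by auto

lemma action_inv:
  assumes "g \<in> carrier G" "x \<in> topspace X"
  shows "\<alpha> (inv g) (\<alpha> g x) = x" "\<alpha> g (\<alpha> (inv g) x) = x"
proof -
  interpret group G by (rule group_G)
  show "\<alpha> (inv g) (\<alpha> g x) = x" using orbit_sym_aux assms by blast
  show "\<alpha> g (\<alpha> (inv g) x) = x"
    using orbit_sym_aux[of "inv g" x] assms by simp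
qed

lemma action_image_inv:
  assumes "g \<in> carrier G" "A \<subseteq> topspace X"
  shows "\<alpha> (inv g) ` \<alpha> g ` A = A" "\<alpha> g ` \<alpha> (inv g) ` A = A"
  using action_inv[OF assms(1)] assms(2) by (force simp: image_image)+

lemma action_openin: "g \<in> carrier G \<Longrightarrow> openin X A \<Longrightarrow> openin X (\<alpha> g ` A)"
  by (meson homeo homeomorphic_map_openness_eq)

lemma action_closedin: "g \<in> carrier G \<Longrightarrow> closedin X A \<Longrightarrow> closedin X (\<alpha> g ` A)"
  by (meson homeo homeomorphic_map_closedness_eq)

lemma invariant_if_subset:
  assumes "A \<subseteq> topspace X" "\<And>g. g \<in> carrier G \<Longrightarrow> \<alpha> g ` A \<subseteq> A" "g \<in> carrier G"
  shows "\<alpha> g ` A = A"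
proof -
  interpret group G by (rule group_G)
  have "\<alpha> (inv g) ` A \<subseteq> A" using assms by simp
  then have "\<alpha> g ` \<alpha> (inv g) ` A \<subseteq> \<alpha> g ` A" by (rule image_mono)
  then have "A \<subseteq> \<alpha> g ` A" using assms(1,3) action_image_inv(2) by metis
  then show ?thesis using assms(2,3) by (intro subset_antisym)
qed

text \<open>Dual form of minimality, obtained by passing to the complement; inclusions suffice
  because the inverse element supplies the other direction.\<close>

lemma minimal_action_invariant_open:
  assumes "minimal_action G X \<alpha>" "openin X U" "U \<noteq> {}" "\<And>g. g \<in> carrier G \<Longrightarrow> \<alpha> g ` U \<subseteq> U"
  shows "U = topspace X"
proof (rule ccontr)
  assume *: "U \<noteq> topspace X"
  have US: "U \<subseteq> topspace X" using assms openin_subset by blast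
  have "\<alpha> g ` (topspace X - U) = topspace X - U" if g: "g \<in> carrier G" for g
    using inj_on_image_set_diff[OF inj_prop[OF g] _ US, of "topspace X"]
      invariant_if_subset[OF US assms(4) g] surj_prop[OF g] by auto
  moreover have "closedin X (topspace X - U)" using assms by blast
  moreover have "topspace X - U \<noteq> {}" "topspace X - U \<subset> topspace X" using * US assms(3) by auto
  ultimately show False using assms(1) unfolding minimal_action_def by metis
qed

text \<open>The translates of \<open>U\<close> form a nonempty invariant open set and therefore
  cover the space; the inverse of the element whose translate contains \<open>x\<close> moves
  \<open>x\<close> into \<open>U\<close>.\<close>

lemma minimal_action_orbit:
  assumes "minimal_action G X \<alpha>" "openin X U" "U \<noteq> {}" "x \<in> topspace X"
  shows "\<exists>g\<in>carrier G. \<alpha> g x \<in> U"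
proof -
  interpret group G by (rule group_G)
  have US: "U \<subseteq> topspace X" using assms openin_subset by blast
  let ?W = "\<Union>g\<in>carrier G. \<alpha> g ` U"
  have "?W = topspace X"
  proof (rule minimal_action_invariant_open[OF assms(1)])
    show "openin X ?W" using action_openin assms(2) by blast
    obtain y where "y \<in> U" using assms(3) by blast
    then have "\<alpha> \<one> y \<in> ?W" by blast
    then show "?W \<noteq> {}" by blast
    fix g assume g: "g \<in> carrier G"
    show "\<alpha> g ` ?W \<subseteq> ?W"
    proof
      fix z assume "z \<in> \<alpha> g ` ?W"
      then obtain h y where "h \<in> carrier G" "y \<in> U" "z = \<alpha> g (\<alpha> h y)" by blast
      then have "z = \<alpha> (g \<otimes> h) y" using composition_rule[of y g h] US g by auto
      then show "z \<in> ?W" using g \<open>h \<in> carrier G\<close> \<open>y \<in> U\<close> by blast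
    qed
  qed
  then obtain g y where g: "g \<in> carrier G" "y \<in> U" "x = \<alpha> g y" using assms(4) by blast
  then have "\<alpha> (inv g) x \<in> U" using action_inv US by auto
  then show ?thesis using g(1) by blast
qed

lemma action_in_topological_full_group:
  assumes "g \<in> carrier G"
  shows "\<alpha> g \<in> carrier (topological_full_group G X \<alpha>)"
proof -
  have "\<forall>x\<in>topspace X. \<exists>U. openin X U \<and> x \<in> U \<and> (\<exists>\<gamma>\<in>carrier G. \<forall>y\<in>U. \<alpha> g y = \<alpha> \<gamma> y)"
    using assms by (intro ballI exI[of _ "topspace X"] conjI bexI[of _ g]) simp_all
  then show ?thesis
    unfolding topological_full_group_def using bij_prop0[OF assms] homeo[OF assms] by simp
qed

lemma extremely_proximal_topological_full_group:
  assumes "extremely_proximal G X \<alpha>"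
  shows "extremely_proximal (topological_full_group G X \<alpha>) X (\<lambda>h. h)"
  unfolding extremely_proximal_def
proof (intro allI impI)
  fix V1 V2
  assume "openin X V1 \<and> closedin X V1 \<and> V1 \<noteq> {} \<and> V1 \<subset> topspace X \<and>
    openin X V2 \<and> closedin X V2 \<and> V2 \<noteq> {} \<and> V2 \<subset> topspace X"
  then obtain g where "g \<in> carrier G" "\<alpha> g ` V2 \<subset> V1"
    using assms unfolding extremely_proximal_def by metis
  then show "\<exists>h\<in>carrier (topological_full_group G X \<alpha>). h ` V2 \<subset> V1"
    using action_in_topological_full_group by blast
qed

text \<open>Invariance is stated through \<open>distr\<close>, which speaks of preimages under a
  measurable map. Continuity gives measurability on the generating open sets, and injectivity turns
  the preimage of the image of \<open>C\<close> back into \<open>C\<close>.\<close>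

lemma invariant_measure_image:
  assumes M: "invariant_borel_probability G X \<alpha> M" and g: "g \<in> carrier G" and C: "openin X C"
  shows "emeasure M (\<alpha> g ` C) = emeasure M C"
proof -
  have sp: "space M = topspace X" and se: "sets M = sigma_sets (topspace X) {U. openin X U}"
    and d: "distr M M (\<alpha> g) = M"
    using M g unfolding invariant_borel_probability_def by auto
  have op: "openin X U \<Longrightarrow> U \<in> sets M" for U unfolding se by blast
  have meas: "\<alpha> g \<in> measurable M M"
  proof (rule measurable_sigma_sets[OF se])
    show "{U. openin X U} \<subseteq> Pow (topspace X)" using openin_subset by blast
    show "\<alpha> g \<in> space M \<rightarrow> topspace X" using surj_prop[OF g] sp by auto
    fix y assume "y \<in> {U. openin X U}"
    then have "openin X {x \<in> topspace X. \<alpha> g x \<in> y}"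
      using homeomorphic_imp_continuous_map[OF homeo[OF g]] unfolding continuous_map_def by auto
    moreover have "{x \<in> topspace X. \<alpha> g x \<in> y} = \<alpha> g -` y \<inter> space M" using sp by auto
    ultimately show "\<alpha> g -` y \<inter> space M \<in> sets M" using op by simp
  qed
  have C': "\<alpha> g -` (\<alpha> g ` C) \<inter> space M = C"
    using inj_prop[OF g] openin_subset[OF C] sp unfolding inj_on_def by auto
  have "emeasure M (\<alpha> g ` C) = emeasure (distr M M (\<alpha> g)) (\<alpha> g ` C)" using d by simp
  also have "\<dots> = emeasure M C"
    using emeasure_distr[OF meas op[OF action_openin[OF g C]]] C' by simp
  finally show ?thesis .
qed

end

text \<open>Stands in for the Cantor set: the proofs only use that clopen sets can be shrunk around each
  of their points.\<close>

locale clopen_action = continuous_action +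
  assumes compact: "compact_space X" and nonempty: "topspace X \<noteq> {}"
    and shrink: "openin X U \<Longrightarrow> x \<in> U \<Longrightarrow> \<exists>C. openin X C \<and> closedin X C \<and> x \<in> C \<and> C \<subset> U"
begin

lemma full_group_preserves_measure:
  assumes M: "invariant_borel_probability G X \<alpha> M" and h: "h \<in> carrier (topological_full_group G X \<alpha>)"
    and A: "openin X A" "closedin X A"
  shows "emeasure M (h ` A) = emeasure M A"
proof -
  have se: "sets M = sigma_sets (topspace X) {U. openin X U}"
    using M unfolding invariant_borel_probability_def by auto
  have op: "openin X U \<Longrightarrow> U \<in> sets M" for U unfolding se by blast
  have hB: "h \<in> Bij (topspace X)" and hh: "homeomorphic_map X X h"
    and loc: "\<And>x. x \<in> topspace X \<Longrightarrow> \<exists>U. openin X U \<and> x \<in> U \<and> (\<exists>\<gamma>\<in>carrier G. \<forall>y\<in>U. h y = \<alpha> \<gamma> y)"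
    using h unfolding topological_full_group_def by auto
  have inj: "inj_on h (topspace X)" using hB by (simp add: Bij_def bij_betw_def)
  have hop: "openin X U \<Longrightarrow> openin X (h ` U)" for U
    by (meson hh homeomorphic_map_openness_eq)
  \<comment> \<open>Asking for all clopen subsets of \<open>B\<close>, not just \<open>B\<close>,
    makes the property stable under overlapping unions: a clopen part \<open>D\<close> of
    \<open>B \<union> C\<close> is cut into \<open>D \<inter> B\<close> and \<open>D - B\<close>,
    each inside one of the two.\<close>
  define good where "good B \<longleftrightarrow> openin X B \<and> closedin X B \<and>
    (\<forall>C. openin X C \<and> closedin X C \<and> C \<subseteq> B \<longrightarrow> emeasure M (h ` C) = emeasure M C)" for B
  have "good A"
    using compact A
  proof (induction rule: compact_clopen_induct)
    case empty
    then show ?case by (auto simp: good_def)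
  next
    case (Un B C)
    have "emeasure M (h ` D) = emeasure M D" if D: "openin X D" "closedin X D" "D \<subseteq> B \<union> C" for D
    proof -
      have 1: "openin X (D \<inter> B)" "closedin X (D \<inter> B)" "openin X (D - B)" "closedin X (D - B)"
        using D Un unfolding good_def by auto
      have "h ` D = h ` (D \<inter> B) \<union> h ` (D - B)" by auto
      moreover have "h ` (D \<inter> B) \<inter> h ` (D - B) = {}"
        using inj openin_subset[OF D(1)] unfolding inj_on_def by blast
      ultimately have "emeasure M (h ` D) = emeasure M (h ` (D \<inter> B)) + emeasure M (h ` (D - B))"
        using plus_emeasure[of "h ` (D \<inter> B)" M "h ` (D - B)"] 1 hop op by auto
      also have "\<dots> = emeasure M (D \<inter> B) + emeasure M (D - B)"
        using Un D 1 unfolding good_def by (metis Diff_subset_conv inf_le2)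
      also have "\<dots> = emeasure M D"
        using plus_emeasure[of "D \<inter> B" M "D - B"] 1 op by (auto simp: Int_Diff_Un Int_Diff_disjoint)
      finally show ?thesis .
    qed
    then show ?case using Un by (auto simp: good_def)
  next
    case (basic x)
    have "x \<in> topspace X" using basic openin_subset[OF A(1)] by auto
    then obtain U \<gamma> where U: "openin X U" "x \<in> U" "\<gamma> \<in> carrier G" "\<And>y. y \<in> U \<Longrightarrow> h y = \<alpha> \<gamma> y"
      using loc by metis
    have "openin X (U \<inter> A)" "x \<in> U \<inter> A" using U(1,2) basic A(1) by auto
    then obtain B where B: "openin X B" "closedin X B" "x \<in> B" "B \<subset> U \<inter> A"
      using shrink by meson
    have "emeasure M (h ` C) = emeasure M C" if "openin X C" "C \<subseteq> B" for C
    proof -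
      have "h ` C = \<alpha> \<gamma> ` C" using that B U(4) by (intro image_cong) auto
      then show ?thesis using invariant_measure_image[OF M U(3) that(1)] by simp
    qed
    then show ?case using B unfolding good_def by blast
  qed
  then show ?thesis using A unfolding good_def by blast
qed

text \<open>An element of the full group moves every point within its orbit and so keeps an
  invariant set \<open>F\<close> inside itself. Yet proximality pushes the complement of a clopen
  set missing \<open>F\<close>, and \<open>F\<close> with it, into that clopen set.\<close>

lemma full_group_proximal_imp_minimal:
  assumes "extremely_proximal (topological_full_group G X \<alpha>) X (\<lambda>h. h)"
  shows "minimal_action G X \<alpha>"
  unfolding minimal_action_def
proof (rule notI, elim exE conjE)
  fix F assume F: "closedin X F" "F \<noteq> {}" "F \<subset> topspace X" "\<forall>g\<in>carrier G. \<alpha> g ` F = F"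
  obtain y where "y \<in> topspace X - F" using F(3) by blast
  then obtain C where C: "openin X C" "closedin X C" "y \<in> C" "C \<subset> topspace X - F"
    using shrink[of "topspace X - F" y] F(1) by blast
  have "C \<subset> topspace X" "C \<noteq> {}" "topspace X - C \<noteq> {}" "topspace X - C \<subset> topspace X"
    "openin X (topspace X - C)" "closedin X (topspace X - C)"
    using C F by auto
  then obtain h where h: "h \<in> carrier (topological_full_group G X \<alpha>)" "h ` (topspace X - C) \<subset> C"
    using assms C(1,2) unfolding extremely_proximal_def by meson
  obtain x where x: "x \<in> F" using F(2) by blast
  then have xt: "x \<in> topspace X" using F by blast
  have hx: "h x \<in> C" using x xt C(4) h(2) by blast
  obtain \<gamma> where "\<gamma> \<in> carrier G" "h x = \<alpha> \<gamma> x"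
    using h(1) xt unfolding topological_full_group_def by auto
  then have "h x \<in> F" using F(4) x by blast
  then show False using hx C(4) by blast
qed

lemma full_group_proximal_imp_no_measure:
  assumes EP: "extremely_proximal (topological_full_group G X \<alpha>) X (\<lambda>h. h)"
  shows "\<nexists>M. invariant_borel_probability G X \<alpha> M"
proof
  assume "\<exists>M. invariant_borel_probability G X \<alpha> M"
  then obtain M where M: "invariant_borel_probability G X \<alpha> M" ..
  then have ps: "prob_space M" and sp: "space M = topspace X"
    and se: "sets M = sigma_sets (topspace X) {U. openin X U}"
    unfolding invariant_borel_probability_def by auto
  interpret prob_space M by (rule ps)
  have op: "openin X U \<Longrightarrow> U \<in> sets M" for U unfolding se by blast
  obtain x where x: "x \<in> topspace X" using nonempty by blast
  obtain A where A: "openin X A" "closedin X A" "x \<in> A" "A \<subset> topspace X"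
    using shrink[OF openin_topspace x] by blast
  then obtain y where y: "y \<in> topspace X - A" by blast
  then obtain B where B: "openin X B" "closedin X B" "y \<in> B" "B \<subset> topspace X - A"
    using shrink[of "topspace X - A" y] A by blast
  \<comment> \<open>Nonempty, because \<open>shrink\<close> returns proper subsets and so
    \<open>B\<close> does not exhaust the complement of \<open>A\<close>.\<close>
  define C where "C = topspace X - A - B"
  have C: "openin X C" "closedin X C" "C \<noteq> {}"
    using B A unfolding C_def by (simp_all add: openin_diff closedin_diff psubset_eq) blast
  have dis: "A \<inter> B = {}" "A \<inter> C = {}" "B \<inter> C = {}" and un: "A \<union> B \<union> C = topspace X"
    and ne: "A \<noteq> {}" "B \<noteq> {}" using A B unfolding C_def by auto
  have key: "measure M P + measure M Q \<le> measure M R"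
    if P: "openin X P" "closedin X P" "P \<noteq> {}" and Q: "openin X Q" "closedin X Q"
      and R: "openin X R" "closedin X R" "R \<noteq> {}" and d: "P \<inter> Q = {}" "(P \<union> Q) \<inter> R = {}" for P Q R
  proof -
    have "P \<union> Q \<subset> topspace X" "R \<subset> topspace X"
      using R d openin_subset[OF P(1)] openin_subset[OF Q(1)] openin_subset[OF R(1)] P(3) by blast+
    moreover have "openin X (P \<union> Q)" "closedin X (P \<union> Q)" "P \<union> Q \<noteq> {}" using P Q by auto
    ultimately obtain h where h: "h \<in> carrier (topological_full_group G X \<alpha>)" "h ` (P \<union> Q) \<subset> R"
      using EP R unfolding extremely_proximal_def by meson
    have "emeasure M (P \<union> Q) = emeasure M (h ` (P \<union> Q))"
      using full_group_preserves_measure[OF M h(1)] \<open>openin X (P \<union> Q)\<close> \<open>closedin X (P \<union> Q)\<close> by simp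
    also have "\<dots> \<le> emeasure M R" using h(2) op R(1) by (intro emeasure_mono) auto
    finally have "measure M (P \<union> Q) \<le> measure M R" by (simp add: emeasure_eq_measure)
    then show ?thesis using finite_measure_Union[of P Q] op P Q d by simp
  qed
  \<comment> \<open>Added up, the three inequalities say that twice the total mass is at most the
    total mass, which is 1.\<close>
  have "measure M A + measure M B \<le> measure M C" "measure M B + measure M C \<le> measure M A"
    "measure M A + measure M C \<le> measure M B"
    using key[of A B C] key[of B C A] key[of A C B] A B C dis ne by blast+
  moreover have "measure M (A \<union> B \<union> C) = measure M A + measure M B + measure M C"
    using finite_measure_Union[of "A \<union> B" C] finite_measure_Union[of A B] op A B C dis by auto
  moreover have "measure M (A \<union> B \<union> C) = 1" using un sp prob_space by simp
  ultimately show False using measure_nonneg[of M A] measure_nonneg[of M B] by linarith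
qed

end

section \<open>Invariant measures from invariant clopen families\<close>

text \<open>Abstracts the balls around a finite invariant vertex set: \<open>\<E> n\<close> will
  consist of the sets of ends through the oriented edges of the \<open>n\<close>-th ball. Only
  finiteness, monotonicity, invariance and the basis property are retained from the tree.\<close>

locale clopen_filtration = continuous_action +
  fixes \<E> :: "nat \<Rightarrow> 'c set set"
  assumes compact: "compact_space X" and nonempty: "topspace X \<noteq> {}"
    and minimal: "minimal_action G X \<alpha>"
    and finite_\<E>: "finite (\<E> n)"
    and clopen_\<E>: "A \<in> \<E> n \<Longrightarrow> openin X A \<and> closedin X A"
    and mono_\<E>: "\<E> n \<subseteq> \<E> (Suc n)"
    and invariant_\<E>: "g \<in> carrier G \<Longrightarrow> A \<in> \<E> n \<Longrightarrow> \<alpha> g ` A \<in> \<E> n"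
    and base_\<E>: "openin X U \<Longrightarrow> x \<in> U \<Longrightarrow> \<exists>n. \<exists>A\<in>\<E> n. x \<in> A \<and> A \<subseteq> U"
begin

section \<open>Atoms of the partition generated by each level, and their uniform weights\<close>

definition atom :: "nat \<Rightarrow> 'c \<Rightarrow> 'c set" where
  "atom n x = {y \<in> topspace X. \<forall>A\<in>\<E> n. x \<in> A \<longleftrightarrow> y \<in> A}"

definition atoms :: "nat \<Rightarrow> 'c set set" where
  "atoms n = atom n ` topspace X"

definition saturated :: "nat \<Rightarrow> 'c set \<Rightarrow> bool" where
  "saturated n A \<longleftrightarrow> A \<subseteq> topspace X \<and> (\<forall>x\<in>A. atom n x \<subseteq> A)"

definition weight :: "nat \<Rightarrow> 'c set \<Rightarrow> real" where
  "weight n A = card {C \<in> atoms n. C \<subseteq> A} / card (atoms n)"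

text \<open>The least level is only a canonical choice; \<open>mass_eq\<close> shows that any level
  at which the set is saturated gives the same value. On sets saturated at no level the value is
  meaningless.\<close>

definition mass :: "'c set \<Rightarrow> real" where
  "mass A = weight (LEAST n. saturated n A) A"

lemma atom_self: "x \<in> topspace X \<Longrightarrow> x \<in> atom n x"
  by (simp add: atom_def)

lemma atom_subset: "atom n x \<subseteq> topspace X"
  by (auto simp: atom_def)

lemma atom_eq: "y \<in> atom n x \<Longrightarrow> atom n y = atom n x"
  unfolding atom_def by auto

lemma atom_Suc: "atom (Suc n) x \<subseteq> atom n x"
  using mono_\<E>[of n] by (auto simp: atom_def)

lemma openin_atom: "openin X (atom n x)"
proof -
  let ?F = "(\<lambda>A. if x \<in> A then A else topspace X - A) ` \<E> n"
  have "atom n x = topspace X \<inter> \<Inter>?F"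
    unfolding atom_def by (auto split: if_splits)
  moreover have "openin X (topspace X \<inter> \<Inter>?F)"
  \<comment> \<open>\<open>openin_Inter\<close> asks for a nonempty family; if \<open>\<E> n\<close>
    is empty, the atom is the whole space.\<close>
  proof (cases "?F = {}")
    case False
    have "openin X (\<Inter>?F)"
      using finite_\<E> False clopen_\<E> by (intro openin_Inter) auto
    then show ?thesis by (simp add: openin_Int)
  qed simp
  ultimately show ?thesis by simp
qed

lemma finite_atoms: "finite (atoms n)"
proof (rule finite_subset)
  show "atoms n \<subseteq> (\<lambda>S. {y \<in> topspace X. \<forall>A\<in>\<E> n. A \<in> S \<longleftrightarrow> y \<in> A}) ` Pow (\<E> n)"
  proof
    fix C assume "C \<in> atoms n"
    then obtain x where "C = atom n x" by (auto simp: atoms_def)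
    then have "C = {y \<in> topspace X. \<forall>A\<in>\<E> n. A \<in> {A \<in> \<E> n. x \<in> A} \<longleftrightarrow> y \<in> A}"
      by (auto simp: atom_def)
    then show "C \<in> (\<lambda>S. {y \<in> topspace X. \<forall>A\<in>\<E> n. A \<in> S \<longleftrightarrow> y \<in> A}) ` Pow (\<E> n)"
      by (rule image_eqI) blast
  qed
qed (simp add: finite_\<E>)

lemma atoms_nonempty: "C \<in> atoms n \<Longrightarrow> C \<noteq> {}"
  using atom_self by (auto simp: atoms_def)

lemma atoms_disjoint: "C \<in> atoms n \<Longrightarrow> D \<in> atoms n \<Longrightarrow> x \<in> C \<Longrightarrow> x \<in> D \<Longrightarrow> C = D"
  using atom_eq unfolding atoms_def by blast

lemma card_atoms_pos: "card (atoms n) > 0"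
  using finite_atoms nonempty by (simp add: card_gt_0_iff atoms_def)

text \<open>Membership of \<open>\<alpha> h u\<close> in a generator is membership of
  \<open>u\<close> in its translate by \<open>inv h\<close>, a generator of the same level. This
  gives one inclusion for every element; the other follows from the inverse.\<close>

lemma atom_image:
  assumes g: "g \<in> carrier G" and x: "x \<in> topspace X"
  shows "\<alpha> g ` atom n x = atom n (\<alpha> g x)"
proof -
  interpret group G by (rule group_G)
  have sub: "\<alpha> h ` atom n y \<subseteq> atom n (\<alpha> h y)" if h: "h \<in> carrier G" and y: "y \<in> topspace X" for h y
  proof
    fix w assume "w \<in> \<alpha> h ` atom n y"
    then obtain z where z: "z \<in> atom n y" and w: "w = \<alpha> h z" by blast
    have zt: "z \<in> topspace X" using z atom_subset by blast
    have in_iff: "\<alpha> h u \<in> A \<longleftrightarrow> u \<in> \<alpha> (inv h) ` A" if "u \<in> topspace X" "A \<in> \<E> n" for u A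
    proof -
      have "A \<subseteq> topspace X" using clopen_\<E>[OF that(2)] openin_subset by blast
      then show ?thesis using action_inv[OF h] that(1) by force
    qed
    have "\<alpha> h y \<in> A \<longleftrightarrow> \<alpha> h z \<in> A" if A: "A \<in> \<E> n" for A
      using in_iff[OF y A] in_iff[OF zt A] z invariant_\<E>[OF inv_closed[OF h] A]
      unfolding atom_def by blast
    then show "w \<in> atom n (\<alpha> h y)"
      using surj_prop[OF h] zt unfolding w atom_def by blast
  qed
  have "\<alpha> (inv g) ` atom n (\<alpha> g x) \<subseteq> atom n x"
    using sub[of "inv g" "\<alpha> g x"] g x action_inv[OF g x] surj_prop[OF g] by auto
  then have "\<alpha> g ` \<alpha> (inv g) ` atom n (\<alpha> g x) \<subseteq> \<alpha> g ` atom n x" by (rule image_mono)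
  then have "atom n (\<alpha> g x) \<subseteq> \<alpha> g ` atom n x"
    using action_image_inv(2)[OF g atom_subset] by simp
  with sub[OF g x] show ?thesis by (rule subset_antisym)
qed

lemma atoms_image: "g \<in> carrier G \<Longrightarrow> C \<in> atoms n \<Longrightarrow> \<alpha> g ` C \<in> atoms n"
  using atom_image surj_prop unfolding atoms_def by blast

text \<open>Minimality enters the construction here: atoms are open, so the orbit of a point of
  \<open>C\<close> meets \<open>D\<close>, and atoms are mapped onto atoms.\<close>

lemma atoms_transitive:
  assumes "C \<in> atoms n" "D \<in> atoms n"
  shows "\<exists>g\<in>carrier G. \<alpha> g ` C = D"
proof -
  obtain x y where x: "x \<in> topspace X" "C = atom n x" and y: "y \<in> topspace X" "D = atom n y"
    using assms unfolding atoms_def by blast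
  have "D \<noteq> {}" using atoms_nonempty assms(2) by blast
  then obtain g where g: "g \<in> carrier G" "\<alpha> g x \<in> D"
    using minimal_action_orbit[OF minimal openin_atom _ x(1)] y by blast
  then have "\<alpha> g ` C = D" using atom_image[OF g(1) x(1)] x(2) y(2) atom_eq by simp
  then show ?thesis using g by blast
qed

text \<open>Serves twice: to compare the numbers of sub-atoms of two atoms of the previous level,
  and to show that \<open>mass\<close> is invariant.\<close>

lemma bij_betw_atoms_image:
  assumes g: "g \<in> carrier G" and A: "A \<subseteq> topspace X"
  shows "bij_betw (image (\<alpha> g)) {C \<in> atoms n. C \<subseteq> A} {C \<in> atoms n. C \<subseteq> \<alpha> g ` A}"
proof (rule bij_betw_byWitness[where f' = "image (\<alpha> (inv g))"])
  interpret group G by (rule group_G)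
  have sub: "C \<subseteq> topspace X" if "C \<in> atoms n" for C using that atom_subset by (auto simp: atoms_def)
  show "\<forall>C\<in>{C \<in> atoms n. C \<subseteq> A}. \<alpha> (inv g) ` \<alpha> g ` C = C"
    using action_image_inv(1)[OF g sub] by blast
  show "\<forall>C\<in>{C \<in> atoms n. C \<subseteq> \<alpha> g ` A}. \<alpha> g ` \<alpha> (inv g) ` C = C"
    using action_image_inv(2)[OF g sub] by blast
  show "image (\<alpha> g) ` {C \<in> atoms n. C \<subseteq> A} \<subseteq> {C \<in> atoms n. C \<subseteq> \<alpha> g ` A}"
    using atoms_image[OF g] by blast
  show "image (\<alpha> (inv g)) ` {C \<in> atoms n. C \<subseteq> \<alpha> g ` A} \<subseteq> {C \<in> atoms n. C \<subseteq> A}"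
    using atoms_image[OF inv_closed[OF g]] action_image_inv(1)[OF g A] by blast
qed

lemma saturated_Suc: "saturated n A \<Longrightarrow> saturated (Suc n) A"
  using atom_Suc unfolding saturated_def by blast

lemma saturated_mono: "n \<le> m \<Longrightarrow> saturated n A \<Longrightarrow> saturated m A"
  by (induction m rule: dec_induct) (auto intro: saturated_Suc)

lemma saturated_topspace: "saturated n (topspace X)"
  using atom_subset by (auto simp: saturated_def)

lemma saturated_image:
  assumes "g \<in> carrier G" "saturated n A"
  shows "saturated n (\<alpha> g ` A)"
proof -
  have "atom n (\<alpha> g x) \<subseteq> \<alpha> g ` A" if "x \<in> A" for x
    using that assms atom_image[OF assms(1), of x n] unfolding saturated_def by blast
  then show ?thesis using assms surj_prop[OF assms(1)] unfolding saturated_def by blast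
qed

text \<open>A generator is saturated at its own level, saturation persists to higher levels, and by
  compactness finitely many generators make up a clopen set.\<close>

lemma clopen_saturated:
  assumes "openin X A" "closedin X A"
  shows "\<exists>n. saturated n A"
  using compact assms
proof (induction rule: compact_clopen_induct)
  case empty
  then show ?case by (auto simp: saturated_def)
next
  case (Un B C)
  then obtain n m where "saturated n B" "saturated m C" by blast
  then have "saturated (max n m) B" "saturated (max n m) C"
    using saturated_mono by (metis max.cobounded1, metis max.cobounded2)
  then have "saturated (max n m) (B \<union> C)" unfolding saturated_def by blast
  then show ?case ..
next
  case (basic x)
  then obtain n B where B: "B \<in> \<E> n" "x \<in> B" "B \<subseteq> A" using base_\<E> assms by meson
  have "openin X B" using clopen_\<E> B by blast
  moreover have "saturated n B"
    using B(1) openin_subset[OF \<open>openin X B\<close>] unfolding saturated_def atom_def by blast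
  ultimately show ?case using B by blast
qed

text \<open>By transitivity all atoms of level \<open>n\<close> contain the same number of atoms of
  level \<open>Suc n\<close>. Refining thus multiplies numerator and denominator of the weight by
  the same positive number.\<close>

lemma weight_Suc:
  assumes A: "saturated n A"
  shows "weight (Suc n) A = weight n A"
proof -
  define ch where "ch B = {C \<in> atoms (Suc n). C \<subseteq> B}" for B
  obtain B0 where B0: "B0 \<in> atoms n" using nonempty unfolding atoms_def by blast
  have ch_card: "card (ch B) = card (ch B0)" if B: "B \<in> atoms n" for B
  proof -
    obtain g where g: "g \<in> carrier G" "\<alpha> g ` B = B0" using atoms_transitive B B0 by blast
    have "B \<subseteq> topspace X" using B atom_subset by (auto simp: atoms_def)
    from bij_betw_same_card[OF bij_betw_atoms_image[OF g(1) this, of "Suc n"]]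
    show ?thesis unfolding ch_def g(2) .
  qed
  have card_ch: "card (ch D) = card {B \<in> atoms n. B \<subseteq> D} * card (ch B0)" if D: "saturated n D" for D
  proof -
    have "ch D = (\<Union>B\<in>{B \<in> atoms n. B \<subseteq> D}. ch B)"
    proof (intro subset_antisym subsetI)
      fix C assume C: "C \<in> ch D"
      then obtain x where x: "x \<in> topspace X" "C = atom (Suc n) x" "x \<in> D"
        using atom_self unfolding ch_def atoms_def by blast
      have "C \<subseteq> atom n x" using x(2) atom_Suc by simp
      moreover have "atom n x \<subseteq> D" using D x(3) unfolding saturated_def by blast
      ultimately show "C \<in> (\<Union>B\<in>{B \<in> atoms n. B \<subseteq> D}. ch B)"
        using C x(1) unfolding ch_def atoms_def by blast
    qed (auto simp: ch_def)
    also have "card \<dots> = (\<Sum>B\<in>{B \<in> atoms n. B \<subseteq> D}. card (ch B))"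
    proof (rule card_UN_disjoint)
      show "finite {B \<in> atoms n. B \<subseteq> D}" using finite_atoms by simp
      show "\<forall>B\<in>{B \<in> atoms n. B \<subseteq> D}. finite (ch B)" unfolding ch_def using finite_atoms by simp
      show "\<forall>B\<in>{B \<in> atoms n. B \<subseteq> D}. \<forall>C\<in>{B \<in> atoms n. B \<subseteq> D}. B \<noteq> C \<longrightarrow> ch B \<inter> ch C = {}"
      proof (intro ballI impI)
        fix B C assume BC: "B \<in> {B \<in> atoms n. B \<subseteq> D}" "C \<in> {B \<in> atoms n. B \<subseteq> D}" "B \<noteq> C"
        have "False" if P: "P \<in> ch B \<inter> ch C" for P
        proof -
          obtain p where "p \<in> P" using P atoms_nonempty[of P "Suc n"] unfolding ch_def by blast
          then have "p \<in> B" "p \<in> C" using P unfolding ch_def by auto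
          then show False using atoms_disjoint BC by blast
        qed
        then show "ch B \<inter> ch C = {}" by blast
      qed
    qed
    also have "\<dots> = card {B \<in> atoms n. B \<subseteq> D} * card (ch B0)"
      using ch_card by simp
    finally show ?thesis .
  qed
  have all: "{C \<in> atoms m. C \<subseteq> topspace X} = atoms m" for m
    using atom_subset by (auto simp: atoms_def)
  have tot: "card (atoms (Suc n)) = card (atoms n) * card (ch B0)"
    using card_ch[OF saturated_topspace] unfolding all ch_def all .
  then have "card (ch B0) > 0" using card_atoms_pos[of "Suc n"] by simp
  then show ?thesis
    using card_ch[OF A] tot unfolding weight_def ch_def[of A] by simp
qed

lemma mass_eq:
  assumes "saturated n A"
  shows "mass A = weight n A"
proof -
  let ?k = "LEAST n. saturated n A"
  have k: "saturated ?k A" using assms by (rule LeastI)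
  have "?k \<le> n" using assms by (rule Least_le)
  then have "weight n A = weight ?k A"
  proof (induction n rule: dec_induct)
    case (step m)
    then show ?case using weight_Suc[OF saturated_mono[OF _ k]] by simp
  qed simp
  then show ?thesis by (simp add: mass_def)
qed

lemma mass_nonneg: "mass A \<ge> 0"
  by (simp add: mass_def weight_def)

lemma mass_empty: "mass {} = 0"
proof -
  have "{C \<in> atoms n. C \<subseteq> {}} = {}" for n using atoms_nonempty by blast
  then show ?thesis by (simp add: mass_def weight_def)
qed

lemma mass_topspace: "mass (topspace X) = 1"
proof -
  have "{C \<in> atoms 0. C \<subseteq> topspace X} = atoms 0" using atom_subset by (auto simp: atoms_def)
  then have "weight 0 (topspace X) = 1" using card_atoms_pos[of 0] by (simp add: weight_def)
  then show ?thesis using mass_eq[OF saturated_topspace] by simp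
qed

lemma mass_add:
  assumes A: "openin X A" "closedin X A" and B: "openin X B" "closedin X B" and "A \<inter> B = {}"
  shows "mass (A \<union> B) = mass A + mass B"
proof -
  obtain n m where "saturated n A" "saturated m B" using clopen_saturated A B by blast
  then have s: "saturated (max n m) A" "saturated (max n m) B"
    using saturated_mono by (metis max.cobounded1, metis max.cobounded2)
  let ?k = "max n m"
  have sU: "saturated ?k (A \<union> B)" using s unfolding saturated_def by blast
  have "{C \<in> atoms ?k. C \<subseteq> A \<union> B} = {C \<in> atoms ?k. C \<subseteq> A} \<union> {C \<in> atoms ?k. C \<subseteq> B}"
  proof (intro subset_antisym subsetI)
    fix C assume "C \<in> {C \<in> atoms ?k. C \<subseteq> A \<union> B}"
    then obtain x where x: "x \<in> topspace X" "C = atom ?k x" "C \<in> atoms ?k" "C \<subseteq> A \<union> B"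
      by (auto simp: atoms_def)
    then have "x \<in> A \<or> x \<in> B" using atom_self by blast
    then have "C \<subseteq> A \<or> C \<subseteq> B" using s x(2) unfolding saturated_def by blast
    then show "C \<in> {C \<in> atoms ?k. C \<subseteq> A} \<union> {C \<in> atoms ?k. C \<subseteq> B}" using x(3) by blast
  qed auto
  moreover have "{C \<in> atoms ?k. C \<subseteq> A} \<inter> {C \<in> atoms ?k. C \<subseteq> B} = {}"
    using atoms_nonempty \<open>A \<inter> B = {}\<close> by blast
  ultimately have "card {C \<in> atoms ?k. C \<subseteq> A \<union> B} =
      card {C \<in> atoms ?k. C \<subseteq> A} + card {C \<in> atoms ?k. C \<subseteq> B}"
    using finite_atoms by (simp add: card_Un_disjoint)
  then show ?thesis
    unfolding mass_eq[OF s(1)] mass_eq[OF s(2)] mass_eq[OF sU] weight_def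
    by (simp add: add_divide_distrib)
qed

lemma mass_image:
  assumes g: "g \<in> carrier G" and A: "openin X A" "closedin X A"
  shows "mass (\<alpha> g ` A) = mass A"
proof -
  obtain n where n: "saturated n A" using clopen_saturated A by blast
  have "A \<subseteq> topspace X" using A openin_subset by blast
  from bij_betw_same_card[OF bij_betw_atoms_image[OF g this, of n]]
  show ?thesis
    unfolding mass_eq[OF n] mass_eq[OF saturated_image[OF g n]] weight_def by simp
qed

section \<open>Extension of the mass to an invariant Borel measure\<close>

definition clopens :: "'c set set" where
  "clopens = {A. openin X A \<and> closedin X A}"

lemma ring_of_sets_clopens: "ring_of_sets (topspace X) clopens"
  by (rule ring_of_setsI)
    (auto simp: clopens_def openin_diff closedin_diff openin_subset dest: openin_subset)

text \<open>The generators form a countable basis of clopen sets, so every open set is a countable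
  union of clopen sets.\<close>

lemma sigma_sets_clopens:
  "sigma_sets (topspace X) {U. openin X U} = sigma_sets (topspace X) clopens"
proof (rule sigma_sets_eqI)
  fix U assume "U \<in> {U. openin X U}"
  then have U: "openin X U" by simp
  have "U = (\<Union>n. \<Union>{A \<in> \<E> n. A \<subseteq> U})" using base_\<E>[OF U] by blast
  moreover have "\<Union>{A \<in> \<E> n. A \<subseteq> U} \<in> clopens" for n
    using finite_\<E>[of n] clopen_\<E>[of _ n] unfolding clopens_def
    by (auto intro!: closedin_Union)
  ultimately show "U \<in> sigma_sets (topspace X) clopens"
    by (metis (no_types, lifting) sigma_sets.Basic sigma_sets.Union)
next
  fix A assume "A \<in> clopens"
  then show "A \<in> sigma_sets (topspace X) {U. openin X U}"
    unfolding clopens_def by (intro sigma_sets.Basic) simp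
qed

text \<open>Caratheodory's theorem for a finite additive function only asks for continuity at the
  empty set. Nested nonempty closed sets in a compact space have a common point, so the sequence in
  question becomes constantly empty.\<close>

lemma mass_extends:
  "\<exists>\<mu>. (\<forall>A\<in>clopens. \<mu> A = ennreal (mass A)) \<and>
     measure_space (topspace X) (sigma_sets (topspace X) clopens) \<mu>"
proof -
  interpret ring_of_sets "topspace X" clopens by (rule ring_of_sets_clopens)
  show ?thesis
  proof (rule caratheodory_empty_continuous)
    show "positive clopens (\<lambda>A. ennreal (mass A))"
      unfolding positive_def by (simp add: mass_empty)
    show "additive clopens (\<lambda>A. ennreal (mass A))"
      unfolding additive_def clopens_def using mass_add mass_nonneg by simp
    fix A :: "nat \<Rightarrow> 'c set"
    assume A: "range A \<subseteq> clopens" "decseq A" "(\<Inter>i. A i) = {}"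
    have cl: "closedin X (A n)" for n using A(1) unfolding clopens_def by blast
    have "\<exists>n. A n = {}"
      using compact_space_imp_nest[OF compact cl _ A(2)] A(3) by blast
    then obtain n where "A n = {}" ..
    then have "A m = {}" if "m \<ge> n" for m using A(2) that unfolding decseq_def by blast
    then have "\<forall>\<^sub>F m in sequentially. ennreal (mass (A m)) = 0"
      using mass_empty unfolding eventually_sequentially by (metis ennreal_0)
    then show "(\<lambda>i. ennreal (mass (A i))) \<longlonglongrightarrow> 0"
      by (rule tendsto_eventually)
  qed simp
qed

lemma invariant_measure_exists: "\<exists>M. invariant_borel_probability G X \<alpha> M"
proof -
  obtain \<mu> where \<mu>: "\<And>A. A \<in> clopens \<Longrightarrow> \<mu> A = ennreal (mass A)"
    and ms: "measure_space (topspace X) (sigma_sets (topspace X) clopens) \<mu>"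
    using mass_extends by blast
  define M where "M = measure_of (topspace X) clopens \<mu>"
  have pow: "clopens \<subseteq> Pow (topspace X)"
    unfolding clopens_def using openin_subset by blast
  have sp: "space M = topspace X" and se: "sets M = sigma_sets (topspace X) clopens"
    unfolding M_def using pow by (simp_all add: space_measure_of sets_measure_of)
  have em: "emeasure M A = ennreal (mass A)" if "A \<in> clopens" for A
  proof -
    have "emeasure M A = \<mu> A"
      unfolding M_def using ms that pow
      by (intro emeasure_measure_of[OF refl]) (auto simp: measure_space_def M_def[symmetric] se)
    then show ?thesis using \<mu> that by simp
  qed
  have top: "topspace X \<in> clopens" by (simp add: clopens_def)
  have "prob_space M"
    by (rule prob_spaceI) (simp add: sp em[OF top] mass_topspace)
  moreover have "distr M M (\<alpha> g) = M" if g: "g \<in> carrier G" for g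
  proof -
    interpret group G by (rule group_G)
    have pre: "\<alpha> g -` A \<inter> topspace X = \<alpha> (inv g) ` A" if "A \<subseteq> topspace X" for A
    proof (intro subset_antisym subsetI)
      fix x assume "x \<in> \<alpha> g -` A \<inter> topspace X"
      then have "x = \<alpha> (inv g) (\<alpha> g x)" "\<alpha> g x \<in> A" using action_inv[OF g] by auto
      then show "x \<in> \<alpha> (inv g) ` A" by blast
    next
      fix x assume "x \<in> \<alpha> (inv g) ` A"
      then obtain a where "a \<in> A" "x = \<alpha> (inv g) a" by blast
      then show "x \<in> \<alpha> g -` A \<inter> topspace X"
        using action_inv(2)[OF g, of a] that surj_prop[OF inv_closed[OF g]] by auto
    qed
    have im: "\<alpha> (inv g) ` A \<in> clopens" if "A \<in> clopens" for A
      using that action_openin[OF inv_closed[OF g]] action_closedin[OF inv_closed[OF g]]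
      unfolding clopens_def by blast
    have meas: "\<alpha> g \<in> measurable M M"
    proof (rule measurable_sigma_sets[OF se pow])
      show "\<alpha> g \<in> space M \<rightarrow> topspace X" using surj_prop[OF g] sp by auto
      fix A assume A: "A \<in> clopens"
      then have "\<alpha> g -` A \<inter> space M = \<alpha> (inv g) ` A" 
        using pre[of A] pow sp by fastforce
      then show "\<alpha> g -` A \<inter> space M \<in> sets M"
        using im[OF A] se by (simp add: sigma_sets.Basic)
    qed
    show ?thesis
    \<comment> \<open>Two finite measures that agree on the intersection-stable generator
      \<open>clopens\<close> coincide; on clopen sets the claim is \<open>mass_image\<close> for the
      inverse element.\<close>
    proof (rule measure_eqI_generator_eq[where E = clopens and \<Omega> = "topspace X" and A = "\<lambda>_. topspace X"])
      show "Int_stable clopens" unfolding Int_stable_def clopens_def by auto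
      show "clopens \<subseteq> Pow (topspace X)" by (rule pow)
      fix A assume A: "A \<in> clopens"
      have "A \<in> sets M" using A se by (simp add: sigma_sets.Basic)
      then have "emeasure (distr M M (\<alpha> g)) A = emeasure M (\<alpha> (inv g) ` A)"
        using emeasure_distr[OF meas] pre[of A] pow A sp by fastforce
      also have "\<dots> = emeasure M A"
        using em[OF A] em[OF im[OF A]] mass_image[OF inv_closed[OF g]] A by (simp add: clopens_def)
      finally show "emeasure (distr M M (\<alpha> g)) A = emeasure M A" .
    next
      show "range (\<lambda>_. topspace X) \<subseteq> clopens" using top by simp
      have "emeasure (distr M M (\<alpha> g)) (topspace X) = emeasure M (\<alpha> (inv g) ` topspace X)"
        using emeasure_distr[OF meas, of "topspace X"] pre[of "topspace X"] se top sp
        by (simp add: sigma_sets.Basic)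
      then show "emeasure (distr M M (\<alpha> g)) (topspace X) \<noteq> \<infinity>" for i :: nat
        using em[OF im[OF top]] by simp
    qed (simp_all add: se)
  qed
  ultimately have "invariant_borel_probability G X \<alpha> M"
    unfolding invariant_borel_probability_def using sp se sigma_sets_clopens by simp
  then show ?thesis ..
qed

end

section \<open>Half-trees and ends\<close>

text \<open>\<open>graph_cycle\<close> wants distinct vertices, so a walk must be made simple: when
  the next vertex already lies on the path, the path is cut at that vertex.\<close>

lemma rtrancl_imp_distinct_path:
  assumes "(x, y) \<in> R\<^sup>*"
  shows "\<exists>p. p \<noteq> [] \<and> hd p = x \<and> last p = y \<and> distinct p \<and> successively (\<lambda>v w. (v, w) \<in> R) p"
  using assms
proof (induction rule: rtrancl_induct)
  case base
  show ?case by (rule exI[of _ "[x]"]) simp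
next
  case (step y z)
  then obtain p where p: "p \<noteq> []" "hd p = x" "last p = y" "distinct p" "successively (\<lambda>v w. (v, w) \<in> R) p"
    by blast
  show ?case
  proof (cases "z \<in> set p")
    case True
    then obtain xs ys where xs: "p = (xs @ [z]) @ ys" by (auto simp: in_set_conv_decomp)
    have "hd (xs @ [z]) = x" using p(2) xs by (cases xs) auto
    moreover have "successively (\<lambda>v w. (v, w) \<in> R) (xs @ [z])"
      using p(5) unfolding xs by (simp only: successively_append_iff)
    ultimately show ?thesis using p(4) xs by (intro exI[of _ "xs @ [z]"]) auto
  next
    case False
    then show ?thesis using p step.hyps(2)
      by (intro exI[of _ "p @ [z]"]) (auto simp: successively_append_iff)
  qed
qed

text \<open>The vertex counterpart of \<open>ends_through E (a, b)\<close>: a ray starting with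
  \<open>a\<close>, \<open>b\<close> stays in it from index 1 on. Reachability in the cut graph
  avoids geodesics and distances.\<close>

definition half_tree :: "('v \<times> 'v) set \<Rightarrow> 'v \<Rightarrow> 'v \<Rightarrow> 'v set" where
  "half_tree E a b = {v. (b, v) \<in> (E - {(a, b), (b, a)})\<^sup>*}"

lemma ray_shift: "ray E r \<Longrightarrow> ray E (\<lambda>n. r (m + n))"
  by (simp add: ray_def)

lemma ray_equiv_shift: "ray E r \<Longrightarrow> (r, \<lambda>n. r (m + n)) \<in> ray_equiv E"
proof -
  assume "ray E r"
  moreover have "\<forall>k. r (m + k) = (\<lambda>n. r (m + n)) (0 + k)" by simp
  ultimately show ?thesis unfolding ray_equiv_def using ray_shift by blast
qed

lemma ray_Cons:
  assumes "ray E r" "(w, r 0) \<in> E" "w \<noteq> r 1"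
  shows "ray E (case_nat w r)" "(r, case_nat w r) \<in> ray_equiv E"
proof -
  show "ray E (case_nat w r)"
    using assms unfolding ray_def by (auto split: nat.split simp: numeral_2_eq_2)
  moreover have "\<forall>k. r (0 + k) = case_nat w r (1 + k)" by simp
  ultimately show "(r, case_nat w r) \<in> ray_equiv E"
    using assms(1) unfolding ray_equiv_def by blast
qed

section \<open>Order among the half-trees of a tree\<close>

locale tree =
  fixes V :: "'v set" and E :: "('v \<times> 'v) set"
  assumes tree: "is_tree V E"
begin

lemma edge_sym: "(a, b) \<in> E \<Longrightarrow> (b, a) \<in> E"
  using tree by (auto simp: is_tree_def simple_graph_def dest: symD)

lemma edge_in_V: "(a, b) \<in> E \<Longrightarrow> a \<in> V" "(a, b) \<in> E \<Longrightarrow> b \<in> V"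
  using tree by (auto simp: is_tree_def simple_graph_def)

lemma edge_neq: "(a, b) \<in> E \<Longrightarrow> a \<noteq> b"
  using tree by (auto simp: is_tree_def simple_graph_def irrefl_def)

lemma connected: "a \<in> V \<Longrightarrow> b \<in> V \<Longrightarrow> (a, b) \<in> E\<^sup>*"
  using tree by (auto simp: is_tree_def)

lemma half_tree_self: "b \<in> half_tree E a b"
  by (simp add: half_tree_def)

lemma half_tree_subset: "b \<in> V \<Longrightarrow> half_tree E a b \<subseteq> V"
proof
  fix v assume "b \<in> V" "v \<in> half_tree E a b"
  then have "(b, v) \<in> (E - {(a, b), (b, a)})\<^sup>*" "b \<in> V" by (auto simp: half_tree_def)
  then show "v \<in> V" by (induction rule: rtrancl_induct) (auto intro: edge_in_V)
qed

lemma half_tree_step: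
  assumes "v \<in> half_tree E a b" "(v, w) \<in> E" "(v, w) \<noteq> (a, b)" "(v, w) \<noteq> (b, a)"
  shows "w \<in> half_tree E a b"
  using assms unfolding half_tree_def by (auto intro: rtrancl_into_rtrancl)

text \<open>A simple path from \<open>b\<close> to \<open>a\<close> avoiding the edge would be
  closed up by this edge to a cycle.\<close>

lemma source_notin_half_tree:
  assumes e: "(a, b) \<in> E"
  shows "a \<notin> half_tree E a b"
proof
  let ?R = "E - {(a, b), (b, a)}"
  assume "a \<in> half_tree E a b"
  then have "(b, a) \<in> ?R\<^sup>*" by (simp add: half_tree_def)
  then obtain p where p: "p \<noteq> []" "hd p = b" "last p = a" "distinct p" "successively (\<lambda>v w. (v, w) \<in> ?R) p"
    using rtrancl_imp_distinct_path[of b a ?R] by blast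
  \<comment> \<open>One vertex would mean \<open>a = b\<close>, and two vertices would make the path
    the deleted edge itself.\<close>
  have "length p \<ge> 3"
  proof (rule ccontr)
    assume "\<not> length p \<ge> 3"
    then consider x where "p = [x]" | x y where "p = [x, y]"
      using p(1) by (cases p rule: remdups_adj.cases) (auto simp: Suc_le_eq)
    then show False using p edge_neq[OF e] by cases auto
  qed
  moreover have "successively (\<lambda>v w. (v, w) \<in> E) p"
    using p(5) by (rule successively_mono) simp
  ultimately have "graph_cycle E p" using p e by (simp add: graph_cycle_def)
  then show False using tree by (auto simp: is_tree_def)
qed

lemma half_tree_disjoint:
  assumes e: "(a, b) \<in> E"
  shows "half_tree E a b \<inter> half_tree E b a = {}"
proof (rule ccontr)
  let ?R = "E - {(a, b), (b, a)}"
  assume "half_tree E a b \<inter> half_tree E b a \<noteq> {}"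
  then obtain v where v: "(b, v) \<in> ?R\<^sup>*" "(a, v) \<in> ?R\<^sup>*"
    by (auto simp: half_tree_def insert_commute)
  have "sym ?R" using edge_sym by (auto simp: sym_def)
  then have "(v, a) \<in> ?R\<^sup>*" using v(2) sym_rtrancl by (metis symD)
  then have "a \<in> half_tree E a b" using v(1) by (auto simp: half_tree_def)
  then show False using source_notin_half_tree e by blast
qed

lemma half_tree_cover:
  assumes "v \<in> V" and e: "(a, b) \<in> E"
  shows "v \<in> half_tree E a b \<or> v \<in> half_tree E b a"
proof -
  have "(b, v) \<in> E\<^sup>*" using connected edge_in_V(2)[OF e] assms(1) .
  then show ?thesis
  proof (induction rule: rtrancl_induct)
    case base
    show ?case using half_tree_self by blast
  next
    case (step v w)
    then show ?case
      using half_tree_step[of v a b w] half_tree_step[of v b a w] half_tree_self[of a b] half_tree_self[of b a]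
      by auto
  qed
qed

lemma half_tree_Compl_iff:
  "v \<in> V \<Longrightarrow> (a, b) \<in> E \<Longrightarrow> v \<notin> half_tree E a b \<longleftrightarrow> v \<in> half_tree E b a"
  using half_tree_cover half_tree_disjoint by blast

text \<open>Every other edge leads to a vertex that is still reachable after the deletion. The
  comparisons of half-trees below rest on this.\<close>

lemma half_tree_exit:
  assumes "(a, b) \<in> E" "v \<in> half_tree E a b" "(v, w) \<in> E" "w \<notin> half_tree E a b"
  shows "v = b \<and> w = a"
  using half_tree_step[OF assms(2,3)] source_notin_half_tree[OF assms(1)] assms by blast

lemma half_tree_stay:
  assumes "(x, y) \<in> R\<^sup>*" "R \<subseteq> E" "(c, d) \<in> E" "x \<in> half_tree E c d" "(d, c) \<notin> R"
  shows "y \<in> half_tree E c d"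
  using assms(1,4)
proof (induction rule: rtrancl_induct)
  case (step y z)
  then show ?case using half_tree_exit[of c d y z] assms(2,3,5) by blast
qed

text \<open>Walk inside the first half-tree from \<open>b\<close>, which lies in the second. Leaving
  the second would require the step from \<open>d\<close> to \<open>c\<close>, so both would belong
  to the first half-tree, contrary to \<open>out\<close>.\<close>

lemma half_tree_mono:
  assumes e: "(a, b) \<in> E" and f: "(c, d) \<in> E" and b: "b \<in> half_tree E c d"
    and out: "c \<notin> half_tree E a b \<or> d \<notin> half_tree E a b"
  shows "half_tree E a b \<subseteq> half_tree E c d"
proof
  fix v assume "v \<in> half_tree E a b"
  then have "(b, v) \<in> (E - {(a, b), (b, a)})\<^sup>*" by (simp add: half_tree_def)
  then have "v \<in> half_tree E a b \<and> v \<in> half_tree E c d"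
  proof (induction rule: rtrancl_induct)
    case base
    show ?case using b half_tree_self by blast
  next
    case (step v w)
    then have "w \<in> half_tree E a b" using half_tree_step[of v a b w] by blast
    moreover have "w \<in> half_tree E c d"
      using half_tree_exit[OF f, of v w] step calculation out by blast
    ultimately show ?case by blast
  qed
  then show "v \<in> half_tree E c d" ..
qed

lemma half_tree_nested:
  assumes "(a, b) \<in> E" "(b, c) \<in> E" "a \<noteq> c"
  shows "half_tree E b c \<subseteq> half_tree E a b"
proof (rule half_tree_mono[OF assms(2,1)])
  show "c \<in> half_tree E a b"
    using half_tree_step[OF half_tree_self[of b a] assms(2)] assms(3) edge_neq[OF assms(1)] by auto
  show "a \<notin> half_tree E b c \<or> b \<notin> half_tree E b c"
    using source_notin_half_tree[OF assms(2)] by blast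
qed

lemma half_tree_siblings_disjoint:
  assumes "(v, w) \<in> E" "(v, w') \<in> E" "w \<noteq> w'"
  shows "half_tree E v w \<inter> half_tree E v w' = {}"
  using half_tree_nested[OF edge_sym[OF assms(1)] assms(2,3)] half_tree_disjoint[OF assms(1)] by blast

text \<open>Follow a walk from \<open>v\<close>: the direction stays the same until the walk returns
  to \<open>v\<close>, where the next step defines a new one.\<close>

lemma half_tree_towards_vertex:
  assumes "v \<in> V" "x \<in> V" "x \<noteq> v"
  shows "\<exists>w. (v, w) \<in> E \<and> x \<in> half_tree E v w"
  using connected[OF assms(1,2)] assms(3)
proof (induction rule: rtrancl_induct)
  case (step x y)
  show ?case
  proof (cases "x = v")
    case True
    then show ?thesis using step.hyps half_tree_self by blast
  next
    case False
    then obtain w where w: "(v, w) \<in> E" "x \<in> half_tree E v w" using step.IH by blast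
    then have "y \<in> half_tree E v w" using half_tree_step[OF w(2) step.hyps(2)] False step.prems by blast
    then show ?thesis using w by blast
  qed
qed simp

lemma half_tree_towards:
  assumes "v \<in> V" "(c, d) \<in> E" "v \<notin> half_tree E c d"
  shows "\<exists>w. (v, w) \<in> E \<and> half_tree E c d \<subseteq> half_tree E v w"
proof -
  have "d \<noteq> v" using assms(3) half_tree_self by blast
  then obtain w where "(v, w) \<in> E" "d \<in> half_tree E v w"
    using half_tree_towards_vertex[OF assms(1) edge_in_V(2)[OF assms(2)]] by blast
  then show ?thesis using half_tree_mono[OF assms(2)] assms(3) by blast
qed

text \<open>Of the two sides of \<open>(a, b)\<close>, the one that does not contain
  \<open>c\<close> has no access to the exit of \<open>half_tree E c d\<close>.\<close>

lemma half_tree_comparable: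
  assumes f: "(c, d) \<in> E" and e: "(a, b) \<in> E" and a: "a \<in> half_tree E c d"
  shows "half_tree E a b \<subseteq> half_tree E c d \<or> half_tree E b a \<subseteq> half_tree E c d"
proof (cases "c \<in> half_tree E a b")
  case True
  then have "c \<notin> half_tree E b a" using half_tree_disjoint[OF e] by blast
  then show ?thesis using half_tree_mono[OF edge_sym[OF e] f a] by blast
next
  case False
  \<comment> \<open>Otherwise the step from \<open>a\<close> to \<open>b\<close> would be the exit
    from \<open>d\<close> to \<open>c\<close>, and then \<open>c = b\<close> would lie in
    \<open>half_tree E a b\<close>.\<close>
  then have "b \<in> half_tree E c d" using half_tree_exit[OF f a e] half_tree_self by blast
  then show ?thesis using half_tree_mono[OF e f] False by blast
qed

lemma walk_reenters_half_tree:
  assumes f: "(c, d) \<in> E"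
  shows "(x, w) \<in> E ^^ n \<Longrightarrow> x \<notin> half_tree E c d \<Longrightarrow> w \<in> half_tree E c d \<Longrightarrow> \<exists>m<n. (d, w) \<in> E ^^ m"
proof (induction n arbitrary: x)
  case (Suc n)
  then obtain y where y: "(x, y) \<in> E" "(y, w) \<in> E ^^ n" by (metis relpow_Suc_D2)
  show ?case
  proof (cases "y \<in> half_tree E c d")
    case True
    then have "y = d" using half_tree_exit[OF f True edge_sym[OF y(1)]] Suc.prems by blast
    then show ?thesis using y by blast
  next
    case False
    then show ?thesis using Suc.IH[OF y(2)] Suc.prems less_SucI by blast
  qed
qed simp

text \<open>The point is connectedness, shown by induction on the length of a walk in the whole tree
  between two vertices of \<open>W\<close>: excursions outside \<open>W\<close> can be cut
  out.\<close>

lemma subtree_Inter_half_trees: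
  assumes F: "F \<subseteq> E" and W: "W = {v \<in> V. \<forall>(c, d)\<in>F. v \<in> half_tree E c d}" and ne: "W \<noteq> {}"
  shows "subtree W (E \<inter> W \<times> W) V E"
proof -
  let ?E = "E \<inter> W \<times> W"
  have conn: "(u, w) \<in> ?E\<^sup>*" if "(u, w) \<in> E ^^ n" "u \<in> W" "w \<in> W" for u w n
    using that
  proof (induction n arbitrary: u rule: less_induct)
    case (less n)
    show ?case
    proof (cases n)
      case 0
      then show ?thesis using less.prems by simp
    next
      case (Suc m)
      then obtain y where y: "(u, y) \<in> E" "(y, w) \<in> E ^^ m" using less.prems by (metis relpow_Suc_D2)
      show ?thesis
      proof (cases "y \<in> W")
        case True
        then have "(y, w) \<in> ?E\<^sup>*" using less.IH[of m y] y Suc less.prems by simp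
        moreover have "(u, y) \<in> ?E" using y True less.prems by blast
        ultimately show ?thesis by (rule converse_rtrancl_into_rtrancl[rotated])
      next
        case False
        \<comment> \<open>The step from \<open>u\<close> leaves a half-tree of the family, which
          forces \<open>u = d\<close>. Coming back to \<open>w\<close> requires entering through
          \<open>d\<close> again, and restarting there gives a shorter walk from
          \<open>u\<close>.\<close>
        then obtain c d where cd: "(c, d) \<in> F" "y \<notin> half_tree E c d"
          using W edge_in_V(2)[OF y(1)] by blast
        have *: "u \<in> half_tree E c d" "w \<in> half_tree E c d" using less.prems W cd by auto
        have f: "(c, d) \<in> E" using cd F by blast
        have "u = d" using half_tree_exit[OF f *(1) y(1) cd(2)] by blast
        moreover obtain k where "k < m" "(d, w) \<in> E ^^ k"
          using walk_reenters_half_tree[OF f y(2) cd(2) *(2)] by blast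
        ultimately show ?thesis using less.IH[of k u] Suc less.prems by simp
      qed
    qed
  qed
  have "(u, w) \<in> ?E\<^sup>*" if "u \<in> W" "w \<in> W" for u w
  proof -
    have "(u, w) \<in> E\<^sup>*" using connected that W by blast
    then obtain n where "(u, w) \<in> E ^^ n" by (auto simp: rtrancl_is_UN_relpow)
    then show ?thesis using conn that by blast
  qed
  moreover have "simple_graph W ?E"
    using edge_sym edge_neq unfolding simple_graph_def sym_def irrefl_def by blast
  moreover have "\<nexists>p. graph_cycle ?E p"
  proof
    assume "\<exists>p. graph_cycle ?E p"
    then obtain p where p: "graph_cycle ?E p" ..
    then have "successively (\<lambda>v w. (v, w) \<in> E) p"
      unfolding graph_cycle_def by (elim conjE, elim successively_mono) simp
    then have "graph_cycle E p" using p unfolding graph_cycle_def by simp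
    then show False using tree unfolding is_tree_def by blast
  qed
  ultimately have "is_tree W ?E" using ne unfolding is_tree_def by blast
  then show ?thesis unfolding subtree_def using W by blast
qed

section \<open>Rays and ends compared with half-trees\<close>

lemma ray_in_V: "ray E r \<Longrightarrow> r n \<in> V"
  using edge_in_V(1) unfolding ray_def by blast

lemma ray_half_tree_antimono:
  assumes "ray E r" "m \<le> n"
  shows "half_tree E (r n) (r (n + 1)) \<subseteq> half_tree E (r m) (r (m + 1))"
  using assms(2)
proof (induction n rule: dec_induct)
  case (step n)
  have "half_tree E (r (n + 1)) (r (n + 2)) \<subseteq> half_tree E (r n) (r (n + 1))"
    using assms(1) unfolding ray_def by (intro half_tree_nested) (auto dest: spec[of _ "n + 1"])
  then show ?case using step.IH by simp
qed simp

lemma ray_in_half_tree: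
  assumes "ray E r" "m < n"
  shows "r n \<in> half_tree E (r m) (r (m + 1))"
proof -
  have "r n \<in> half_tree E (r (n - 1)) (r (n - 1 + 1))" using half_tree_self assms(2) by simp
  then show ?thesis using ray_half_tree_antimono[OF assms(1), of m "n - 1"] assms(2) by fastforce
qed

text \<open>\<open>ends_through\<close> mentions one special representative; this makes the
  information available for every representative, since two of them share a tail.\<close>

lemma ends_through_eventually:
  assumes w: "\<omega> \<in> ends_through E (a, b)" and r: "r \<in> \<omega>"
  shows "\<exists>N. \<forall>n\<ge>N. r n \<in> half_tree E a b"
proof -
  obtain s where we: "\<omega> \<in> ends E" and s: "s \<in> \<omega>" "s 0 = a" "s 1 = b"
    using w unfolding ends_through_def by auto
  have "(r, s) \<in> ray_equiv E" using end_equiv[OF we r] s by blast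
  then obtain m n where mn: "\<And>k. r (m + k) = s (n + k)" unfolding ray_equiv_def by blast
  \<comment> \<open>The shift by one skips index 0 of \<open>s\<close>, which is \<open>a\<close>
    and lies outside the half-tree.\<close>
  have "r k \<in> half_tree E a b" if "k \<ge> m + 1" for k
  proof -
    have "r k = s (n + (k - m))" using mn[of "k - m"] that by simp
    then show ?thesis using ray_in_half_tree[OF end_ray[OF we s(1)], of 0 "n + (k - m)"] s that by simp
  qed
  then show ?thesis by blast
qed

lemma ends_through_disjoint:
  assumes "half_tree E a b \<inter> half_tree E c d = {}"
  shows "ends_through E (a, b) \<inter> ends_through E (c, d) = {}"
proof (rule ccontr)
  assume "ends_through E (a, b) \<inter> ends_through E (c, d) \<noteq> {}"
  then obtain \<omega> where w: "\<omega> \<in> ends_through E (a, b)" "\<omega> \<in> ends_through E (c, d)" by blast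
  then have "\<omega> \<in> ends E" by (simp add: ends_through_def)
  then obtain r where r: "r \<in> \<omega>" using end_nonempty by blast
  obtain N M where "\<forall>n\<ge>N. r n \<in> half_tree E a b" "\<forall>n\<ge>M. r n \<in> half_tree E c d"
    using ends_through_eventually w r by metis
  then have "r (max N M) \<in> half_tree E a b \<inter> half_tree E c d" by simp
  then show False using assms by blast
qed

text \<open>Move the starting point along a walk: towards a neighbour that is the next vertex of the
  ray, drop the first vertex; towards any other neighbour, prepend it, which creates no
  backtrack.\<close>

lemma ray_from_vertex:
  assumes r: "ray E r" and v: "v \<in> V"
  shows "\<exists>s. ray E s \<and> s 0 = v \<and> (r, s) \<in> ray_equiv E"
  using connected[OF ray_in_V[OF r, of 0] v]
proof (induction rule: rtrancl_induct)
  case base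
  show ?case using r ray_equiv_shift[OF r, of 0] by auto
next
  case (step v w)
  then obtain s where s: "ray E s" "s 0 = v" "(r, s) \<in> ray_equiv E" by blast
  have tr: "(r, t) \<in> ray_equiv E" if "(s, t) \<in> ray_equiv E" for t
    using equiv_ray_equiv s(3) that by (meson equivE transD)
  show ?case
  proof (cases "w = s 1")
    case True
    then show ?thesis
      using ray_shift[OF s(1), of 1] tr[OF ray_equiv_shift[OF s(1), of 1]] by (intro exI[of _ "\<lambda>n. s (1 + n)"]) simp
  next
    case False
    then show ?thesis
      using ray_Cons[OF s(1), of w] edge_sym[OF step.hyps(2)] s(2) tr by (intro exI[of _ "case_nat w s"]) simp
  qed
qed

lemma end_from_vertex:
  assumes w: "\<omega> \<in> ends E" and v: "v \<in> V"
  shows "\<exists>r\<in>\<omega>. r 0 = v"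
proof -
  obtain r where r: "r \<in> \<omega>" using end_nonempty[OF w] by blast
  then obtain s where "s 0 = v" "(r, s) \<in> ray_equiv E"
    using ray_from_vertex[OF end_ray[OF w r] v] by blast
  then show ?thesis using end_equiv[OF w r] by blast
qed

lemma ends_through_cover:
  assumes w: "\<omega> \<in> ends E" and e: "(a, b) \<in> E"
  shows "\<omega> \<in> ends_through E (a, b) \<or> \<omega> \<in> ends_through E (b, a)"
proof -
  obtain r where r: "r \<in> \<omega>" "r 0 = a" using end_from_vertex[OF w edge_in_V(1)[OF e]] by blast
  show ?thesis
  proof (cases "r 1 = b")
    case True
    then show ?thesis using w r unfolding ends_through_def by auto
  next
    case False
    then have "case_nat b r \<in> \<omega>"
      using ray_Cons(2)[OF end_ray[OF w r(1)], of b] edge_sym[OF e] r end_equiv[OF w r(1)] by auto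
    then show ?thesis using w r unfolding ends_through_def by (auto intro!: bexI[of _ "case_nat b r"])
  qed
qed

lemma ends_through_Compl:
  assumes "(a, b) \<in> E"
  shows "ends E - ends_through E (a, b) = ends_through E (b, a)"
  using ends_through_cover[OF _ assms] ends_through_disjoint[OF half_tree_disjoint[OF assms]]
  by (auto simp: ends_through_def)

text \<open>Disjoint half-trees have disjoint sets of ends, and the complement of the ends through
  an edge is the set of ends through its reversal, so inclusion is obtained by passing to
  complements.\<close>

lemma ends_through_mono_half_tree:
  assumes f: "(c, d) \<in> E" and sub: "half_tree E a b \<subseteq> half_tree E c d"
  shows "ends_through E (a, b) \<subseteq> ends_through E (c, d)"
proof -
  have "half_tree E a b \<inter> half_tree E d c = {}" using sub half_tree_disjoint[OF f] by blast
  moreover have "ends_through E (a, b) \<subseteq> ends E" by (auto simp: ends_through_def)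
  ultimately show ?thesis using ends_through_disjoint[of a b d c] ends_through_Compl[OF f] by blast
qed

lemma openin_ends_through: "e \<in> E \<Longrightarrow> openin (boundary_topology E) (ends_through E e)"
  unfolding boundary_topology_def by (intro topology_generated_by_Basis) blast

lemma closedin_ends_through:
  assumes "(a, b) \<in> E"
  shows "closedin (boundary_topology E) (ends_through E (a, b))"
proof -
  have "ends_through E (a, b) \<subseteq> ends E" by (auto simp: ends_through_def)
  then show ?thesis
    using openin_ends_through[OF edge_sym[OF assms]] ends_through_Compl[OF assms]
    unfolding closedin_def topspace_boundary_topology by simp
qed

end

section \<open>Trees without leaves: every edge carries an end\<close>

locale leafless_tree = tree +
  assumes leafless: "leafless V E"
begin

lemma edge_continues:
  assumes "(a, b) \<in> E"
  shows "\<exists>c. (b, c) \<in> E \<and> c \<noteq> a"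
proof (rule ccontr)
  assume "\<nexists>c. (b, c) \<in> E \<and> c \<noteq> a"
  then have "{w. (b, w) \<in> E} = {a}" using edge_sym[OF assms] by blast
  then have "leaf V E b" using edge_in_V[OF assms] by (simp add: leaf_def)
  then show False using leafless by (simp add: leafless_def)
qed

lemma ray_through_edge:
  assumes "(a, b) \<in> E"
  shows "\<exists>r. ray E r \<and> r 0 = a \<and> r 1 = b"
proof -
  \<comment> \<open>The choice is made among oriented edges rather than vertices, because excluding
    a backtrack requires the previous vertex.\<close>
  have "\<exists>p. \<forall>n. (p n \<in> E \<and> (n = 0 \<longrightarrow> p n = (a, b))) \<and>
      (fst (p (Suc n)) = snd (p n) \<and> snd (p (Suc n)) \<noteq> fst (p n))"
  proof (rule dependent_nat_choice)
    show "\<exists>p. p \<in> E \<and> (0 = (0::nat) \<longrightarrow> p = (a, b))" using assms by blast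
    fix p and n :: nat assume "p \<in> E \<and> (n = 0 \<longrightarrow> p = (a, b))"
    then obtain c where "(snd p, c) \<in> E" "c \<noteq> fst p" using edge_continues[of "fst p" "snd p"] by auto
    then show "\<exists>q. (q \<in> E \<and> (Suc n = 0 \<longrightarrow> q = (a, b))) \<and> fst q = snd p \<and> snd q \<noteq> fst p"
      by (intro exI[of _ "(snd p, c)"]) simp
  qed
  then obtain p where p: "p 0 = (a, b)"
    "\<And>n. p n \<in> E" "\<And>n. fst (p (Suc n)) = snd (p n)" "\<And>n. snd (p (Suc n)) \<noteq> fst (p n)"
    by blast
  have "ray E (\<lambda>n. fst (p n))"
    unfolding ray_def
  proof (intro conjI allI)
    fix n
    show "(fst (p n), fst (p (n + 1))) \<in> E" using p(2)[of n] p(3)[of n] by simp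
    show "fst (p n) \<noteq> fst (p (n + 2))" using p(3)[of "Suc n"] p(4)[of n] by simp
  qed
  moreover have "fst (p 0) = a" "fst (p 1) = b" using p(1) p(3)[of 0] by auto
  ultimately show ?thesis by blast
qed

lemma ends_through_nonempty:
  assumes "(a, b) \<in> E"
  shows "ends_through E (a, b) \<noteq> {}"
proof -
  obtain r where r: "ray E r" "r 0 = a" "r 1 = b" using ray_through_edge[OF assms] by blast
  let ?w = "ray_equiv E `` {r}"
  have "?w \<in> ends E" unfolding ends_def using r(1) by (intro quotientI) simp
  moreover have "r \<in> ?w" using equiv_class_self[OF equiv_ray_equiv] r(1) by simp
  ultimately show ?thesis using r unfolding ends_through_def by auto
qed

lemma finite_neighbours:
  assumes X: "compact_space (boundary_topology E)" and v: "v \<in> V"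
  shows "finite {w. (v, w) \<in> E}"
proof (rule finite_disjoint_open_cover[OF X, where U = "\<lambda>w. ends_through E (v, w)"])
  show "openin (boundary_topology E) (ends_through E (v, w))" if "w \<in> {w. (v, w) \<in> E}" for w
    using that openin_ends_through by blast
  show "ends_through E (v, w) \<noteq> {}" if "w \<in> {w. (v, w) \<in> E}" for w
    using that ends_through_nonempty by blast
  show "disjoint_family_on (\<lambda>w. ends_through E (v, w)) {w. (v, w) \<in> E}"
    unfolding disjoint_family_on_def using ends_through_disjoint half_tree_siblings_disjoint by blast
  show "topspace (boundary_topology E) \<subseteq> (\<Union>w\<in>{w. (v, w) \<in> E}. ends_through E (v, w))"
    unfolding topspace_boundary_topology
  proof
    fix \<omega> assume w: "\<omega> \<in> ends E"
    then obtain r where r: "r \<in> \<omega>" "r 0 = v" using end_from_vertex v by blast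
    have "(r 0, r (0 + 1)) \<in> E" using end_ray[OF w r(1)] unfolding ray_def by blast
    then show "\<omega> \<in> (\<Union>w\<in>{w. (v, w) \<in> E}. ends_through E (v, w))"
      using r w unfolding ends_through_def by auto
  qed
qed

end

section \<open>The action on the boundary\<close>

lemma ends_eq_if_common_ray:
  assumes "\<omega> \<in> ends E" "\<omega>' \<in> ends E" "r \<in> \<omega>" "r \<in> \<omega>'"
  shows "\<omega> = \<omega>'"
  using assms end_equiv by blast

locale leafless_tree_action = leafless_tree V E + group_action G V \<phi>
  for V :: "'v set" and E :: "('v \<times> 'v) set" and G :: "('g, 'm) monoid_scheme" (structure)
    and \<phi> :: "'g \<Rightarrow> 'v \<Rightarrow> 'v" +
  assumes edge_iff: "g \<in> carrier G \<Longrightarrow> v \<in> V \<Longrightarrow> w \<in> V \<Longrightarrow> (v, w) \<in> E \<longleftrightarrow> (\<phi> g v, \<phi> g w) \<in> E"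
begin

abbreviation "X \<equiv> boundary_topology E"
abbreviation "\<alpha> \<equiv> boundary_action E \<phi>"

lemma is_group: "group G"
  using group_hom group_hom.axioms(1) by auto

lemma one_closed: "\<one> \<in> carrier G" and inv_closed: "g \<in> carrier G \<Longrightarrow> inv g \<in> carrier G"
  and mult_closed: "g \<in> carrier G \<Longrightarrow> h \<in> carrier G \<Longrightarrow> g \<otimes> h \<in> carrier G"
proof -
  interpret group G by (rule is_group)
  show "\<one> \<in> carrier G" by simp
  show "inv g \<in> carrier G" if "g \<in> carrier G" using that by simp
  show "g \<otimes> h \<in> carrier G" if "g \<in> carrier G" "h \<in> carrier G" using that by simp
qed

lemma vertex_one: "v \<in> V \<Longrightarrow> \<phi> \<one> v = v"
  using id_eq_one by (metis restrict_apply')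

lemma vertex_closed: "g \<in> carrier G \<Longrightarrow> v \<in> V \<Longrightarrow> \<phi> g v \<in> V"
  using element_image by blast

lemma vertex_inv:
  assumes "g \<in> carrier G" "v \<in> V"
  shows "\<phi> (inv g) (\<phi> g v) = v" "\<phi> g (\<phi> (inv g) v) = v"
proof -
  interpret group G by (rule is_group)
  show "\<phi> (inv g) (\<phi> g v) = v" using orbit_sym_aux assms by blast
  show "\<phi> g (\<phi> (inv g) v) = v" using orbit_sym_aux[of "inv g" v] assms by simp
qed

lemma vertex_inj: "g \<in> carrier G \<Longrightarrow> v \<in> V \<Longrightarrow> w \<in> V \<Longrightarrow> \<phi> g v = \<phi> g w \<longleftrightarrow> v = w"
  using inj_prop by (metis inj_onD)

lemma edge_image: "g \<in> carrier G \<Longrightarrow> (v, w) \<in> E \<Longrightarrow> (\<phi> g v, \<phi> g w) \<in> E"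
  using edge_iff edge_in_V by blast

lemma half_tree_image:
  assumes g: "g \<in> carrier G" and e: "(a, b) \<in> E" and v: "v \<in> half_tree E a b"
  shows "\<phi> g v \<in> half_tree E (\<phi> g a) (\<phi> g b)"
proof -
  have ab: "a \<in> V" "b \<in> V" using edge_in_V[OF e] by auto
  have "(b, v) \<in> (E - {(a, b), (b, a)})\<^sup>*" using v by (simp add: half_tree_def)
  then show ?thesis
  proof (induction rule: rtrancl_induct)
    case base
    show ?case by (rule half_tree_self)
  next
    case (step v w)
    then have vw: "(v, w) \<in> E" "v \<in> V" "w \<in> V" "(v, w) \<noteq> (a, b)" "(v, w) \<noteq> (b, a)"
      using edge_in_V by blast+
    then show ?case
      using half_tree_step[OF step.IH edge_image[OF g vw(1)]] vertex_inj[OF g] ab by auto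
  qed
qed

lemma half_tree_image_iff:
  assumes g: "g \<in> carrier G" and e: "(a, b) \<in> E" and v: "v \<in> V"
  shows "\<phi> g v \<in> half_tree E (\<phi> g a) (\<phi> g b) \<longleftrightarrow> v \<in> half_tree E a b"
  using half_tree_image[OF g e] half_tree_image[OF inv_closed[OF g] edge_image[OF g e], of "\<phi> g v"]
    vertex_inv[OF g] edge_in_V[OF e] v by auto

lemma half_tree_subset_image:
  assumes g: "g \<in> carrier G" and e: "(a, b) \<in> E" and f: "(c, d) \<in> E"
    and sub: "half_tree E a b \<subseteq> half_tree E c d"
  shows "half_tree E (\<phi> g a) (\<phi> g b) \<subseteq> half_tree E (\<phi> g c) (\<phi> g d)"
proof
  fix v assume v: "v \<in> half_tree E (\<phi> g a) (\<phi> g b)"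
  have vV: "v \<in> V" using v half_tree_subset[OF vertex_closed[OF g edge_in_V(2)[OF e]]] by blast
  define u where "u = \<phi> (inv g) v"
  have u: "u \<in> V" "v = \<phi> g u" using vertex_inv(2)[OF g vV] vertex_closed[OF inv_closed[OF g] vV] by (auto simp: u_def)
  then show "v \<in> half_tree E (\<phi> g c) (\<phi> g d)"
    using half_tree_image_iff[OF g e] half_tree_image_iff[OF g f] v sub by auto
qed

lemma ray_image:
  assumes g: "g \<in> carrier G" and r: "ray E r"
  shows "ray E (\<phi> g \<circ> r)"
  using r edge_image[OF g] vertex_inj[OF g ray_in_V[OF r] ray_in_V[OF r]] unfolding ray_def by simp

lemma ray_equiv_image:
  assumes g: "g \<in> carrier G" and rs: "(r, s) \<in> ray_equiv E"
  shows "(\<phi> g \<circ> r, \<phi> g \<circ> s) \<in> ray_equiv E"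
proof -
  obtain m n where mn: "\<forall>k. r (m + k) = s (n + k)" and "ray E r" "ray E s"
    using rs unfolding ray_equiv_def by blast
  moreover have "\<forall>k. (\<phi> g \<circ> r) (m + k) = (\<phi> g \<circ> s) (n + k)" using mn by simp
  ultimately show ?thesis using ray_image[OF g] unfolding ray_equiv_def by blast
qed

lemma ray_inv:
  assumes "g \<in> carrier G" "ray E r"
  shows "\<phi> (inv g) \<circ> (\<phi> g \<circ> r) = r" "\<phi> g \<circ> (\<phi> (inv g) \<circ> r) = r"
  using vertex_inv[OF assms(1)] ray_in_V[OF assms(2)] by auto

lemma action_mem: "\<omega> \<in> ends E \<Longrightarrow> r \<in> \<omega> \<Longrightarrow> \<phi> g \<circ> r \<in> \<alpha> g \<omega>"
  by (simp add: boundary_action_def)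

text \<open>The image of a class is contained in a class because tails are preserved; that it is the
  whole class follows by applying the inverse element.\<close>

lemma action_ends:
  assumes g: "g \<in> carrier G" and w: "\<omega> \<in> ends E"
  shows "\<alpha> g \<omega> \<in> ends E"
proof -
  obtain r where r: "r \<in> \<omega>" using end_nonempty[OF w] by blast
  have ray: "ray E r" using end_ray[OF w r] .
  have "(\<lambda>r. \<phi> g \<circ> r) ` \<omega> = ray_equiv E `` {\<phi> g \<circ> r}"
  proof (intro subset_antisym subsetI)
    fix s assume "s \<in> (\<lambda>r. \<phi> g \<circ> r) ` \<omega>"
    then obtain t where "t \<in> \<omega>" "s = \<phi> g \<circ> t" by blast
    then show "s \<in> ray_equiv E `` {\<phi> g \<circ> r}"
      using ray_equiv_image[OF g, of r t] end_equiv[OF w r] by auto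
  next
    fix s assume "s \<in> ray_equiv E `` {\<phi> g \<circ> r}"
    then have s: "(\<phi> g \<circ> r, s) \<in> ray_equiv E" by simp
    then have "(r, \<phi> (inv g) \<circ> s) \<in> ray_equiv E"
      using ray_equiv_image[OF inv_closed[OF g] s] ray_inv(1)[OF g ray] by simp
    then have "\<phi> (inv g) \<circ> s \<in> \<omega>" using end_equiv[OF w r] by blast
    moreover have "ray E s" using s unfolding ray_equiv_def by blast
    ultimately show "s \<in> (\<lambda>r. \<phi> g \<circ> r) ` \<omega>" using ray_inv(2)[OF g] by (metis imageI)
  qed
  then have "\<alpha> g \<omega> = ray_equiv E `` {\<phi> g \<circ> r}" using w by (simp add: boundary_action_def)
  then show ?thesis unfolding ends_def using ray_image[OF g ray] by (simp add: quotientI)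
qed

lemma action_mult:
  assumes g: "g \<in> carrier G" and h: "h \<in> carrier G" and w: "\<omega> \<in> ends E"
  shows "\<alpha> (g \<otimes> h) \<omega> = \<alpha> g (\<alpha> h \<omega>)"
proof -
  have "\<phi> (g \<otimes> h) \<circ> r = \<phi> g \<circ> (\<phi> h \<circ> r)" if "r \<in> \<omega>" for r
    using composition_rule[OF _ g h] ray_in_V[OF end_ray[OF w that]] by auto
  then have "(\<lambda>r. \<phi> (g \<otimes> h) \<circ> r) ` \<omega> = (\<lambda>r. \<phi> g \<circ> r) ` (\<lambda>r. \<phi> h \<circ> r) ` \<omega>"
    unfolding image_image by (intro image_cong) auto
  then show ?thesis
    using w action_ends[OF h w] by (simp add: boundary_action_def)
qed

lemma action_one: "\<omega> \<in> ends E \<Longrightarrow> \<alpha> \<one> \<omega> = \<omega>"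
proof -
  assume w: "\<omega> \<in> ends E"
  have "\<phi> \<one> \<circ> r = r" if "r \<in> \<omega>" for r
    using vertex_one ray_in_V[OF end_ray[OF w that]] by auto
  then show ?thesis using w by (simp add: boundary_action_def)
qed

lemma action_inv:
  assumes "g \<in> carrier G" "\<omega> \<in> ends E"
  shows "\<alpha> (inv g) (\<alpha> g \<omega>) = \<omega>" "\<alpha> g (\<alpha> (inv g) \<omega>) = \<omega>"
  using action_mult[of "inv g" g] action_mult[of g "inv g"] assms inv_closed action_one
    group.l_inv[OF is_group] group.r_inv[OF is_group] by simp_all

lemma action_Bij: "g \<in> carrier G \<Longrightarrow> \<alpha> g \<in> Bij (ends E)"
proof -
  assume g: "g \<in> carrier G"
  have "bij_betw (\<alpha> g) (ends E) (ends E)"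
    using action_inv[OF g] action_ends[OF g] action_ends[OF inv_closed[OF g]]
    by (intro bij_betw_byWitness[where f' = "\<alpha> (inv g)"]) auto
  then show ?thesis by (simp add: Bij_def boundary_action_def)
qed

lemma group_action_ends: "group_action G (ends E) \<alpha>"
proof (rule group_action.intro)
  have "compose (ends E) (\<alpha> g) (\<alpha> h) = \<alpha> (g \<otimes> h)" if "g \<in> carrier G" "h \<in> carrier G" for g h
  proof
    fix \<omega>
    show "compose (ends E) (\<alpha> g) (\<alpha> h) \<omega> = \<alpha> (g \<otimes> h) \<omega>"
      using action_mult[OF that] by (cases "\<omega> \<in> ends E") (auto simp: compose_def boundary_action_def)
  qed
  then have "\<alpha> \<in> hom G (BijGroup (ends E))"
    using action_Bij unfolding hom_def BijGroup_def by auto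
  then show "group_hom G (BijGroup (ends E)) \<alpha>"
    using is_group group_BijGroup by (simp add: group_hom_def group_hom_axioms_def)
qed

lemma action_ends_through:
  assumes g: "g \<in> carrier G" and e: "(a, b) \<in> E"
  shows "\<alpha> g ` ends_through E (a, b) = ends_through E (\<phi> g a, \<phi> g b)"
proof -
  have sub: "\<alpha> h ` ends_through E (c, d) \<subseteq> ends_through E (\<phi> h c, \<phi> h d)" if h: "h \<in> carrier G" for h c d
  proof
    fix \<omega>' assume "\<omega>' \<in> \<alpha> h ` ends_through E (c, d)"
    then obtain \<omega> r where w: "\<omega> \<in> ends E" "\<omega>' = \<alpha> h \<omega>" and r: "r \<in> \<omega>" "r 0 = c" "r 1 = d"
      unfolding ends_through_def by auto
    then show "\<omega>' \<in> ends_through E (\<phi> h c, \<phi> h d)"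
      using action_ends[OF h w(1)] action_mem[OF w(1) r(1), of h] r
      unfolding ends_through_def by (auto intro!: bexI[of _ "\<phi> h \<circ> r"])
  qed
  have "\<alpha> (inv g) ` ends_through E (\<phi> g a, \<phi> g b) \<subseteq> ends_through E (a, b)"
    using sub[OF inv_closed[OF g], of "\<phi> g a" "\<phi> g b"] vertex_inv(1)[OF g] edge_in_V[OF e] by simp
  then have "\<alpha> g ` \<alpha> (inv g) ` ends_through E (\<phi> g a, \<phi> g b) \<subseteq> \<alpha> g ` ends_through E (a, b)"
    by (rule image_mono)
  moreover have "\<alpha> g ` \<alpha> (inv g) ` ends_through E (\<phi> g a, \<phi> g b) = ends_through E (\<phi> g a, \<phi> g b)"
    using action_inv(2)[OF g] unfolding image_image by (force simp: ends_through_def)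
  ultimately show ?thesis using sub[OF g, of a b] by simp
qed

lemma action_open:
  assumes g: "g \<in> carrier G" and U: "openin X U"
  shows "openin X (\<alpha> g ` U)"
  unfolding boundary_topology_base
proof (intro conjI ballI)
  have US: "U \<subseteq> ends E" and base: "\<And>\<omega>. \<omega> \<in> U \<Longrightarrow> \<exists>e\<in>E. \<omega> \<in> ends_through E e \<and> ends_through E e \<subseteq> U"
    using U unfolding boundary_topology_base by auto
  show "\<alpha> g ` U \<subseteq> ends E" using US action_ends[OF g] by blast
  fix \<omega>' assume "\<omega>' \<in> \<alpha> g ` U"
  then obtain \<omega> where w: "\<omega> \<in> U" "\<omega>' = \<alpha> g \<omega>" by blast
  then obtain a b where e: "(a, b) \<in> E" "\<omega> \<in> ends_through E (a, b)" "ends_through E (a, b) \<subseteq> U"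
    using base by (metis surj_pair)
  have "\<omega>' \<in> ends_through E (\<phi> g a, \<phi> g b) \<and> ends_through E (\<phi> g a, \<phi> g b) \<subseteq> \<alpha> g ` U"
    using action_ends_through[OF g e(1)] e w by blast
  then show "\<exists>e\<in>E. \<omega>' \<in> ends_through E e \<and> ends_through E e \<subseteq> \<alpha> g ` U"
    using edge_image[OF g e(1)] by blast
qed

lemma action_homeomorphic: "g \<in> carrier G \<Longrightarrow> homeomorphic_map X X (\<alpha> g)"
proof (rule bijective_open_imp_homeomorphic_map)
  assume g: "g \<in> carrier G"
  have b: "bij_betw (\<alpha> g) (ends E) (ends E)" using action_Bij[OF g] by (simp add: Bij_def)
  show "\<alpha> g ` topspace X = topspace X" "inj_on (\<alpha> g) (topspace X)"
    using b unfolding bij_betw_def topspace_boundary_topology by auto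
  show "open_map X X (\<alpha> g)" using action_open[OF g] by (simp add: open_map_def)
  have "openin X {\<omega> \<in> ends E. \<alpha> g \<omega> \<in> U}" if U: "openin X U" for U
  proof -
    have US: "U \<subseteq> ends E" using U unfolding boundary_topology_base by auto
    have "{\<omega> \<in> ends E. \<alpha> g \<omega> \<in> U} = \<alpha> (inv g) ` U"
    proof (intro subset_antisym subsetI)
      fix \<omega> assume "\<omega> \<in> {\<omega> \<in> ends E. \<alpha> g \<omega> \<in> U}"
      then show "\<omega> \<in> \<alpha> (inv g) ` U" using action_inv(1)[OF g, of \<omega>] by (auto intro: rev_image_eqI)
    next
      fix \<omega> assume "\<omega> \<in> \<alpha> (inv g) ` U"
      then show "\<omega> \<in> {\<omega> \<in> ends E. \<alpha> g \<omega> \<in> U}"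
        using action_inv(2)[OF g] action_ends[OF inv_closed[OF g]] US by auto
    qed
    then show ?thesis using action_open[OF inv_closed[OF g] U] by simp
  qed
  then show "continuous_map X X (\<alpha> g)"
    using action_ends[OF g] by (auto simp: continuous_map_def topspace_boundary_topology)
qed

lemma continuous_action_boundary: "continuous_action G X \<alpha>"
  unfolding continuous_action_def continuous_action_axioms_def topspace_boundary_topology
  by (intro conjI allI impI group_action_ends action_homeomorphic)

end

section \<open>Topological properties of the Cantor set\<close>

lemma cantor_space_compact: "cantor_space X \<Longrightarrow> compact_space X"
  unfolding cantor_space_def
  by (drule homeomorphic_compact_space) (simp add: compact_space_product_topology compact_space_discrete_topology)

lemma cantor_space_Hausdorff: "cantor_space X \<Longrightarrow> Hausdorff_space X"
  unfolding cantor_space_def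
  by (drule homeomorphic_Hausdorff_space) (simp add: Hausdorff_space_product_topology)

lemma cantor_space_nonempty:
  assumes "cantor_space X"
  shows "topspace X \<noteq> {}"
proof -
  let ?P = "product_topology (\<lambda>_::nat. discrete_topology (UNIV :: bool set)) UNIV"
  obtain f where "homeomorphic_map X ?P f"
    using assms unfolding cantor_space_def homeomorphic_space by blast
  then have "f ` topspace X = topspace ?P" by (rule homeomorphic_imp_surjective_map)
  moreover have "topspace ?P \<noteq> {}" by (simp only: topspace_product_topology PiE_eq_empty_iff) simp
  ultimately show ?thesis by blast
qed

lemma cantor_space_perfect:
  assumes X: "cantor_space X" and U: "openin X U" "x \<in> U"
  shows "\<exists>y\<in>U. y \<noteq> x"
proof (rule ccontr)
  let ?P = "product_topology (\<lambda>_::nat. discrete_topology (UNIV :: bool set)) UNIV"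
  assume "\<not> (\<exists>y\<in>U. y \<noteq> x)"
  then have Ux: "U = {x}" using U(2) by blast
  obtain f where f: "homeomorphic_map X ?P f"
    using X unfolding cantor_space_def homeomorphic_space by blast
  have "openin ?P (f ` U)" using f U(1) by (meson homeomorphic_map_openness_eq)
  then have "openin ?P {f x}" using Ux by simp
  then obtain B where B: "finite {i. B i \<noteq> (UNIV :: bool set)}" "f x \<in> Pi\<^sub>E UNIV B" "Pi\<^sub>E UNIV B \<subseteq> {f x}"
    unfolding openin_product_topology_alt by (auto simp: topspace_discrete_topology)
  \<comment> \<open>A basic open box restricts finitely many coordinates only; flipping a free one
    produces a second point in it.\<close>
  obtain i where i: "B i = UNIV" using B(1) ex_new_if_finite[OF infinite_UNIV_nat B(1)] by blast
  have "(f x)(i := \<not> f x i) \<in> Pi\<^sub>E UNIV B" using B(2) i by (auto simp: PiE_iff)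
  then have "(f x)(i := \<not> f x i) = f x" using B(3) by blast
  then show False by (metis fun_upd_same)
qed

section \<open>Minimal actions on trees\<close>

context leafless_tree_action
begin

lemma invariant_vertices:
  assumes W: "W \<subseteq> V" "\<And>g. g \<in> carrier G \<Longrightarrow> \<phi> g ` W \<subseteq> W" and g: "g \<in> carrier G"
  shows "\<phi> g ` W = W" "map_prod (\<phi> g) (\<phi> g) ` (E \<inter> W \<times> W) = E \<inter> W \<times> W"
proof -
  have inv: "\<phi> (inv g) w \<in> W" "\<phi> g (\<phi> (inv g) w) = w" if "w \<in> W" for w
    using W(2)[OF inv_closed[OF g]] vertex_inv(2)[OF g] that W(1) by blast+
  have "W \<subseteq> \<phi> g ` W" using inv by (metis imageI subsetI)
  then show "\<phi> g ` W = W" using W(2)[OF g] by blast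
  show "map_prod (\<phi> g) (\<phi> g) ` (E \<inter> W \<times> W) = E \<inter> W \<times> W"
  proof (intro subset_antisym subsetI)
    fix p assume "p \<in> map_prod (\<phi> g) (\<phi> g) ` (E \<inter> W \<times> W)"
    then show "p \<in> E \<inter> W \<times> W" using edge_image[OF g] W(2)[OF g] by auto
  next
    fix p assume p: "p \<in> E \<inter> W \<times> W"
    obtain v w where vw: "p = (v, w)" by fastforce
    then have "(\<phi> (inv g) v, \<phi> (inv g) w) \<in> E \<inter> W \<times> W"
      using p inv(1) edge_image[OF inv_closed[OF g]] by auto
    moreover have "p = map_prod (\<phi> g) (\<phi> g) (\<phi> (inv g) v, \<phi> (inv g) w)"
      using vw p inv(2) by auto
    ultimately show "p \<in> map_prod (\<phi> g) (\<phi> g) ` (E \<inter> W \<times> W)" by blast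
  qed
qed

text \<open>If the orbit of \<open>v\<close> avoided the half-tree, \<open>v\<close> would lie in
  every translate of the opposite one. The intersection of these translates is an invariant subtree
  that contains \<open>v\<close> but not \<open>b\<close>.\<close>

lemma minimal_orbit_meets_half_tree:
  assumes min: "minimal_tree_action G V E \<phi>" and e: "(a, b) \<in> E" and v: "v \<in> V"
  shows "\<exists>g\<in>carrier G. \<phi> g v \<in> half_tree E a b"
proof (rule ccontr)
  interpret group G by (rule is_group)
  assume no: "\<not> (\<exists>g\<in>carrier G. \<phi> g v \<in> half_tree E a b)"
  define F where "F = (\<lambda>g. (\<phi> g b, \<phi> g a)) ` carrier G"
  define W where "W = {u \<in> V. \<forall>(c, d)\<in>F. u \<in> half_tree E c d}"
  have ab: "a \<in> V" "b \<in> V" using edge_in_V[OF e] by auto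
  have e': "(b, a) \<in> E" using edge_sym[OF e] .
  have F: "F \<subseteq> E" unfolding F_def using edge_image e' by blast
  have "v \<in> half_tree E (\<phi> g b) (\<phi> g a)" if g: "g \<in> carrier G" for g
  proof -
    have "\<phi> (inv g) v \<in> half_tree E b a"
      using half_tree_Compl_iff[OF vertex_closed[OF inv_closed[OF g] v] e] no inv_closed[OF g] by blast
    then show ?thesis using half_tree_image[OF g e'] vertex_inv(2)[OF g v] by metis
  qed
  then have vW: "v \<in> W" unfolding W_def F_def using v by auto
  have "(\<phi> \<one> b, \<phi> \<one> a) \<in> F" unfolding F_def by (rule imageI) (rule one_closed)
  then have "(b, a) \<in> F" using vertex_one ab by simp
  then have bW: "b \<notin> W" unfolding W_def using source_notin_half_tree[OF e'] by auto
  have "\<phi> h u \<in> W" if h: "h \<in> carrier G" and u: "u \<in> W" for h u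
  proof -
    have uV: "u \<in> V" using u by (simp add: W_def)
    have "\<phi> h u \<in> half_tree E (\<phi> g b) (\<phi> g a)" if g: "g \<in> carrier G" for g
    proof -
      \<comment> \<open>To test \<open>\<phi> h u\<close> against the translate by \<open>g\<close>,
        test \<open>u\<close> against the translate by \<open>inv h \<otimes> g\<close> and move
        everything by \<open>h\<close>.\<close>
      have k: "inv h \<otimes> g \<in> carrier G" using g h by simp
      then have "u \<in> half_tree E (\<phi> (inv h \<otimes> g) b) (\<phi> (inv h \<otimes> g) a)"
        using u unfolding W_def F_def by blast
      then have "\<phi> h u \<in> half_tree E (\<phi> h (\<phi> (inv h \<otimes> g) b)) (\<phi> h (\<phi> (inv h \<otimes> g) a))"
        using half_tree_image[OF h edge_image[OF k e']] by blast
      moreover have "\<phi> h (\<phi> (inv h \<otimes> g) x) = \<phi> g x" if "x \<in> V" for x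
        using composition_rule[OF that inv_closed[OF h] g] vertex_inv(2)[OF h vertex_closed[OF g that]] by simp
      ultimately show ?thesis using ab by simp
    qed
    then show ?thesis using vertex_closed[OF h uV] unfolding W_def F_def by auto
  qed
  then have "\<And>h. h \<in> carrier G \<Longrightarrow> \<phi> h ` W \<subseteq> W" by (intro image_subsetI)
  moreover have "W \<subseteq> V" unfolding W_def by blast
  ultimately have "\<forall>g\<in>carrier G. \<phi> g ` W = W \<and> map_prod (\<phi> g) (\<phi> g) ` (E \<inter> W \<times> W) = E \<inter> W \<times> W"
    using invariant_vertices[of W] by simp
  moreover have "subtree W (E \<inter> W \<times> W) V E"
    by (rule subtree_Inter_half_trees[OF F W_def]) (use vW in blast)
  moreover have "(W, E \<inter> W \<times> W) \<noteq> (V, E)" using bW ab by blast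
  ultimately show False using min unfolding minimal_tree_action_def by metis
qed

text \<open>From every vertex missed by some half-tree of the family, all such half-trees lie in the same
  direction. Following these directions gives rays which merge, so that their common end is fixed.\<close>

lemma parabolic_if_half_trees_meet:
  assumes T: "T \<subseteq> E" and inv: "\<And>g c d. g \<in> carrier G \<Longrightarrow> (c, d) \<in> T \<Longrightarrow> (\<phi> g c, \<phi> g d) \<in> T"
    and meet: "\<And>c d c' d'. (c, d) \<in> T \<Longrightarrow> (c', d') \<in> T \<Longrightarrow> half_tree E c d \<inter> half_tree E c' d' \<noteq> {}"
    and miss: "\<And>v. v \<in> V \<Longrightarrow> \<exists>(c, d)\<in>T. v \<notin> half_tree E c d"
  shows "parabolic G E \<phi>"
proof -
  define dir where "dir v w \<longleftrightarrow> (v, w) \<in> E \<and> (\<exists>(c, d)\<in>T. half_tree E c d \<subseteq> half_tree E v w)" for v w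
  have dir_meet: "half_tree E v w \<inter> half_tree E v' w' \<noteq> {}" if "dir v w" "dir v' w'" for v w v' w'
    using that meet unfolding dir_def by blast
  have dir_ex: "\<exists>w. dir v w" if "v \<in> V" for v
  proof -
    obtain c d where "(c, d) \<in> T" "v \<notin> half_tree E c d" using miss[OF \<open>v \<in> V\<close>] by blast
    then show ?thesis using half_tree_towards[of v c d] \<open>v \<in> V\<close> T unfolding dir_def by blast
  qed
  \<comment> \<open>Half-trees towards different neighbours are disjoint, but each would contain a
    member of the family \<open>T\<close>, whose members meet. Uniqueness also makes the later
    choice \<open>nx\<close> equivariant.\<close>
  have dir_unique: "w = w'" if "dir v w" "dir v w'" for v w w'
    using half_tree_siblings_disjoint[of v w w'] dir_meet[OF that] that unfolding dir_def by blast
  have dir_image: "dir (\<phi> g v) (\<phi> g w)" if g: "g \<in> carrier G" and d: "dir v w" for g v w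
  proof -
    obtain c d where cd: "(c, d) \<in> T" "half_tree E c d \<subseteq> half_tree E v w" and e: "(v, w) \<in> E"
      using d unfolding dir_def by blast
    then show ?thesis
      using inv[OF g cd(1)] half_tree_subset_image[OF g _ e cd(2)] edge_image[OF g e] T unfolding dir_def by blast
  qed
  define nx where "nx v = (SOME w. dir v w)" for v
  have nx: "dir v (nx v)" if "v \<in> V" for v
    unfolding nx_def using someI_ex[OF dir_ex[OF that]] .
  have nxE: "(v, nx v) \<in> E" "nx v \<in> V" if "v \<in> V" for v
    using nx[OF that] edge_in_V(2) unfolding dir_def by blast+
  have nx_image: "nx (\<phi> g v) = \<phi> g (nx v)" if "g \<in> carrier G" "v \<in> V" for g v
    using dir_unique[OF nx[OF vertex_closed[OF that]] dir_image[OF that(1) nx[OF that(2)]]] .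
  \<comment> \<open>Otherwise both sides of one edge would contain a member of the family.\<close>
  have no_return: "nx (nx v) \<noteq> v" if "v \<in> V" for v
  proof
    assume "nx (nx v) = v"
    then have "dir v (nx v)" "dir (nx v) v" using nx[OF that] nx[OF nxE(2)[OF that]] by auto
    then show False using dir_meet[of v "nx v" "nx v" v] half_tree_disjoint[OF nxE(1)[OF that]] by blast
  qed
  \<comment> \<open>If neither vertex pointed at the other, their chosen half-trees would lie on
    opposite sides of the edge joining them.\<close>
  have nx_adj: "nx u = v \<or> nx v = u" if uv: "(u, v) \<in> E" for u v
  proof (rule ccontr)
    assume *: "\<not> (nx u = v \<or> nx v = u)"
    have V: "u \<in> V" "v \<in> V" using edge_in_V[OF uv] by auto
    have "half_tree E u (nx u) \<subseteq> half_tree E v u"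
      using half_tree_nested[OF edge_sym[OF uv] nxE(1)[OF V(1)]] * by blast
    moreover have "half_tree E v (nx v) \<subseteq> half_tree E u v"
      using half_tree_nested[OF uv nxE(1)[OF V(2)]] * by blast
    ultimately show False using half_tree_disjoint[OF uv] dir_meet[OF nx[OF V(1)] nx[OF V(2)]] by blast
  qed
  define r where "r v n = (nx ^^ n) v" for v n
  have rV: "r v n \<in> V" if "v \<in> V" for v n
    unfolding r_def using that nxE(2) by (induction n) auto
  have ray: "ray E (r v)" if "v \<in> V" for v
  proof -
    have "r v (n + 1) = nx (r v n)" "r v (n + 2) = nx (nx (r v n))" for n by (simp_all add: r_def)
    then show ?thesis using nxE(1)[OF rV[OF that]] no_return[OF rV[OF that]] unfolding ray_def by metis
  qed
  have r_step: "r v (1 + k) = r (nx v) k" for v k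
    unfolding r_def by (simp add: funpow_swap1)
  have merge_nx: "(r v, r (nx v)) \<in> ray_equiv E" if "v \<in> V" for v
  proof -
    have "\<forall>k. r v (1 + k) = r (nx v) (0 + k)" using r_step by simp
    then show ?thesis using ray[OF that] ray[OF nxE(2)[OF that]] unfolding ray_equiv_def by blast
  qed
  have sym: "(s, t) \<in> ray_equiv E" if "(t, s) \<in> ray_equiv E" for s t
    using equiv_ray_equiv that by (meson equivE symD)
  have trans: "(s, u) \<in> ray_equiv E" if "(s, t) \<in> ray_equiv E" "(t, u) \<in> ray_equiv E" for s t u
    using equiv_ray_equiv that by (meson equivE transD)
  \<comment> \<open>By \<open>nx_adj\<close>, of two adjacent vertices one has as its ray a tail of
    the other's ray; connectedness then puts all these rays into one end.\<close>
  have merge: "(r u, r v) \<in> ray_equiv E" if u: "u \<in> V" and "v \<in> V" for u v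
    using connected[OF that]
  proof (induction rule: rtrancl_induct)
    case base
    show ?case using trans[OF merge_nx[OF u] sym[OF merge_nx[OF u]]] .
  next
    case (step y z)
    then have "(r y, r z) \<in> ray_equiv E"
      using nx_adj[OF step.hyps(2)] merge_nx sym edge_in_V[OF step.hyps(2)] by metis
    then show ?case using step.IH trans by blast
  qed
  obtain v where v: "v \<in> V" using tree unfolding is_tree_def by blast
  define \<omega> where "\<omega> = ray_equiv E `` {r v}"
  have w: "\<omega> \<in> ends E" unfolding \<omega>_def ends_def using ray[OF v] by (simp add: quotientI)
  have rw: "r u \<in> \<omega>" if "u \<in> V" for u unfolding \<omega>_def using merge[OF v that] by simp
  have "\<alpha> g \<omega> = \<omega>" if g: "g \<in> carrier G" for g
  proof -
    have "\<phi> g (r v n) = r (\<phi> g v) n" for n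
    proof (induction n)
      case (Suc n)
      then show ?case using nx_image[OF g rV[OF v], of n] by (simp add: r_def)
    qed (simp add: r_def)
    then have "\<phi> g \<circ> r v = r (\<phi> g v)" by auto
    then have "r (\<phi> g v) \<in> \<alpha> g \<omega>" using action_mem[OF w rw[OF v], of g] by simp
    then show ?thesis
      using ends_eq_if_common_ray[OF action_ends[OF g w] w _ rw[OF vertex_closed[OF g v]]] by blast
  qed
  then show ?thesis unfolding parabolic_def using w by blast
qed

lemma half_tree_image_disjoint:
  assumes min: "minimal_tree_action G V E \<phi>" and np: "\<not> parabolic G E \<phi>" and e: "(a, b) \<in> E"
  shows "\<exists>g\<in>carrier G. half_tree E (\<phi> g a) (\<phi> g b) \<inter> half_tree E a b = {}"
proof (rule ccontr)
  assume no: "\<not> ?thesis"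
  define T where "T = (\<lambda>g. (\<phi> g a, \<phi> g b)) ` carrier G"
  have ab: "a \<in> V" "b \<in> V" using edge_in_V[OF e] by auto
  have TE: "T \<subseteq> E" unfolding T_def using edge_image e by blast
  have inv: "(\<phi> g c, \<phi> g d) \<in> T" if g: "g \<in> carrier G" and cd: "(c, d) \<in> T" for g c d
  proof -
    obtain h where h: "h \<in> carrier G" "c = \<phi> h a" "d = \<phi> h b" using cd unfolding T_def by blast
    then have "\<phi> g c = \<phi> (g \<otimes> h) a" "\<phi> g d = \<phi> (g \<otimes> h) b" using composition_rule ab g by auto
    then show ?thesis unfolding T_def using mult_closed[OF g h(1)] by blast
  qed
  \<comment> \<open>Translating by \<open>inv h\<close> turns the second half-tree into that of
    \<open>(a, b)\<close>, for which the assumption applies.\<close>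
  have meet: "half_tree E c d \<inter> half_tree E c' d' \<noteq> {}" if cd: "(c, d) \<in> T" and cd': "(c', d') \<in> T" for c d c' d'
  proof -
    obtain h where h: "h \<in> carrier G" "c' = \<phi> h a" "d' = \<phi> h b" using cd' unfolding T_def by blast
    have "(\<phi> (inv h) c, \<phi> (inv h) d) \<in> T" using inv[OF inv_closed[OF h(1)] cd] .
    then obtain g where g: "g \<in> carrier G" "\<phi> (inv h) c = \<phi> g a" "\<phi> (inv h) d = \<phi> g b"
      unfolding T_def by blast
    obtain x where x: "x \<in> half_tree E (\<phi> g a) (\<phi> g b)" "x \<in> half_tree E a b" using no g(1) by blast
    have cdV: "c \<in> V" "d \<in> V" using cd TE edge_in_V by blast+
    have "\<phi> h x \<in> half_tree E (\<phi> h (\<phi> g a)) (\<phi> h (\<phi> g b))"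
      using half_tree_image[OF h(1) edge_image[OF g(1) e] x(1)] .
    then have "\<phi> h x \<in> half_tree E c d"
      using vertex_inv(2)[OF h(1)] cdV unfolding g(2,3)[symmetric] by simp
    moreover have "\<phi> h x \<in> half_tree E c' d'" using half_tree_image[OF h(1) e x(2)] h by simp
    ultimately show ?thesis by blast
  qed
  \<comment> \<open>Minimality moves \<open>v\<close> into the opposite half-tree; pulling back
    shows that a translate of the given one misses \<open>v\<close>.\<close>
  have miss: "\<exists>(c, d)\<in>T. v \<notin> half_tree E c d" if v: "v \<in> V" for v
  proof -
    obtain g where g: "g \<in> carrier G" "\<phi> g v \<in> half_tree E b a"
      using minimal_orbit_meets_half_tree[OF min edge_sym[OF e] v] by blast
    then have "\<phi> g v \<notin> half_tree E a b" using half_tree_disjoint[OF e] by blast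
    then have "v \<notin> half_tree E (\<phi> (inv g) a) (\<phi> (inv g) b)"
      using half_tree_image_iff[OF inv_closed[OF g(1)] e vertex_closed[OF g(1) v]] vertex_inv(1)[OF g(1) v] by simp
    moreover have "(\<phi> (inv g) a, \<phi> (inv g) b) \<in> T" unfolding T_def using inv_closed[OF g(1)] by blast
    ultimately show ?thesis by blast
  qed
  show False using parabolic_if_half_trees_meet[OF TE inv meet miss] np by blast
qed

lemma half_tree_image_subset:
  assumes min: "minimal_tree_action G V E \<phi>" and np: "\<not> parabolic G E \<phi>"
    and e: "(a, b) \<in> E" and f: "(c, d) \<in> E"
  shows "\<exists>g\<in>carrier G. half_tree E (\<phi> g a) (\<phi> g b) \<subseteq> half_tree E c d"
proof -
  have ab: "a \<in> V" "b \<in> V" using edge_in_V[OF e] by auto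
  obtain g where g: "g \<in> carrier G" "\<phi> g a \<in> half_tree E c d"
    using minimal_orbit_meets_half_tree[OF min f ab(1)] by blast
  have ge: "(\<phi> g a, \<phi> g b) \<in> E" using edge_image[OF g(1) e] .
  consider "half_tree E (\<phi> g a) (\<phi> g b) \<subseteq> half_tree E c d"
    | "half_tree E (\<phi> g b) (\<phi> g a) \<subseteq> half_tree E c d"
    using half_tree_comparable[OF f ge g(2)] by blast
  then show ?thesis
  proof cases
    case 1
    then show ?thesis using g(1) by blast
  next
    case 2
    \<comment> \<open>The wrong side of the edge landed in the target, so the half-tree is first
      moved by \<open>h\<close> into its complement and then by \<open>g\<close>.\<close>
    obtain h where h: "h \<in> carrier G" "half_tree E (\<phi> h a) (\<phi> h b) \<inter> half_tree E a b = {}"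
      using half_tree_image_disjoint[OF min np e] by blast
    have he: "(\<phi> h a, \<phi> h b) \<in> E" using edge_image[OF h(1) e] .
    have "half_tree E (\<phi> h a) (\<phi> h b) \<subseteq> half_tree E b a"
      using h(2) half_tree_Compl_iff[OF _ e] half_tree_subset[OF edge_in_V(2)[OF he]] by blast
    then have "half_tree E (\<phi> g (\<phi> h a)) (\<phi> g (\<phi> h b)) \<subseteq> half_tree E (\<phi> g b) (\<phi> g a)"
      by (rule half_tree_subset_image[OF g(1) he edge_sym[OF e]])
    then have "half_tree E (\<phi> (g \<otimes> h) a) (\<phi> (g \<otimes> h) b) \<subseteq> half_tree E c d"
      using 2 composition_rule[OF _ g(1) h(1)] ab by auto
    then show ?thesis using mult_closed[OF g(1) h(1)] by blast
  qed
qed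

end

section \<open>The implications for a boundary that is a Cantor set\<close>

locale cantor_tree_action = leafless_tree_action +
  assumes cantor: "cantor_space (boundary_topology E)"
begin

lemma boundary_compact: "compact_space X"
  using cantor by (rule cantor_space_compact)

lemma ends_basis:
  assumes "openin X U" "\<omega> \<in> U"
  obtains a b where "(a, b) \<in> E" "\<omega> \<in> ends_through E (a, b)" "ends_through E (a, b) \<subseteq> U"
proof -
  have "\<exists>e\<in>E. \<omega> \<in> ends_through E e \<and> ends_through E e \<subseteq> U"
    using assms unfolding boundary_topology_base by blast
  then obtain e where "e \<in> E" "\<omega> \<in> ends_through E e" "ends_through E e \<subseteq> U" by (elim bexE conjE)
  then show thesis using that[of "fst e" "snd e"] by simp
qed

text \<open>Perfectness supplies a second end in \<open>U\<close> and the Hausdorff property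
  separates it off. The strictness provides \<open>shrink\<close> and the strict inclusion in
  extreme proximality.\<close>

lemma ends_basis_proper:
  assumes U: "openin X U" "\<omega> \<in> U"
  obtains a b where "(a, b) \<in> E" "\<omega> \<in> ends_through E (a, b)" "ends_through E (a, b) \<subset> U"
proof -
  obtain \<omega>' where w': "\<omega>' \<in> U" "\<omega>' \<noteq> \<omega>" using cantor_space_perfect[OF cantor U] by blast
  have "\<omega> \<in> topspace X" "\<omega>' \<in> topspace X" using openin_subset[OF U(1)] U(2) w'(1) by auto
  then obtain S T where ST: "openin X S" "openin X T" "\<omega> \<in> S" "\<omega>' \<in> T" "disjnt S T"
    using cantor_space_Hausdorff[OF cantor] w'(2) unfolding Hausdorff_space_def by metis
  have "openin X (U \<inter> S)" "\<omega> \<in> U \<inter> S" using U ST by auto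
  then obtain a b where ab: "(a, b) \<in> E" "\<omega> \<in> ends_through E (a, b)" "ends_through E (a, b) \<subseteq> U \<inter> S"
    by (rule ends_basis)
  have "\<omega>' \<notin> S" using ST(4,5) unfolding disjnt_def by blast
  then show thesis using that[OF ab(1,2)] ab(3) w'(1) by blast
qed

lemma clopen_action_boundary: "clopen_action G X \<alpha>"
proof (rule clopen_action.intro[OF continuous_action_boundary], unfold_locales)
  show "compact_space X" by (rule boundary_compact)
  show "topspace X \<noteq> {}" using cantor by (rule cantor_space_nonempty)
  fix U \<omega> assume "openin X U" "\<omega> \<in> U"
  then obtain a b where "(a, b) \<in> E" "\<omega> \<in> ends_through E (a, b)" "ends_through E (a, b) \<subset> U"
    by (rule ends_basis_proper)
  then show "\<exists>C. openin X C \<and> closedin X C \<and> \<omega> \<in> C \<and> C \<subset> U"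
    using openin_ends_through closedin_ends_through by metis
qed

lemma minimal_nonparabolic_imp_extremely_proximal:
  assumes min: "minimal_tree_action G V E \<phi>" and np: "\<not> parabolic G E \<phi>"
  shows "extremely_proximal G X \<alpha>"
  unfolding extremely_proximal_def
proof (intro allI impI, elim conjE)
  fix V1 V2
  assume V1: "openin X V1" "V1 \<noteq> {}" and V2: "closedin X V2" "V2 \<subset> topspace X"
  obtain \<omega>1 where "\<omega>1 \<in> V1" using V1 by blast
  then obtain c d where cd: "(c, d) \<in> E" "ends_through E (c, d) \<subset> V1"
    using ends_basis_proper[OF V1(1)] by metis
  obtain \<omega>2 where "\<omega>2 \<in> topspace X - V2" using V2 by blast
  \<comment> \<open>The names are reversed on purpose: the edge \<open>(b, a)\<close> is chosen off
    \<open>V2\<close>, so that \<open>V2\<close> lies in the ends through \<open>(a, b)\<close>, the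
    half-tree to be moved.\<close>
  then obtain b a where ba: "(b, a) \<in> E" "ends_through E (b, a) \<subseteq> topspace X - V2"
    using ends_basis[of "topspace X - V2" \<omega>2] V2(1) by blast
  have V2sub: "V2 \<subseteq> ends_through E (a, b)"
    using ends_through_Compl[OF ba(1)] ba(2) V2(2) unfolding topspace_boundary_topology by blast
  have ab: "(a, b) \<in> E" using edge_sym[OF ba(1)] .
  obtain g where g: "g \<in> carrier G" "half_tree E (\<phi> g a) (\<phi> g b) \<subseteq> half_tree E c d"
    using half_tree_image_subset[OF min np ab cd(1)] by blast
  have "\<alpha> g ` V2 \<subseteq> \<alpha> g ` ends_through E (a, b)" using V2sub by (rule image_mono)
  also have "\<dots> = ends_through E (\<phi> g a, \<phi> g b)" using action_ends_through[OF g(1) ab] .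
  also have "\<dots> \<subseteq> ends_through E (c, d)" using ends_through_mono_half_tree[OF cd(1) g(2)] .
  finally have "\<alpha> g ` V2 \<subset> V1" using cd(2) by blast
  then show "\<exists>g\<in>carrier G. \<alpha> g ` V2 \<subset> V1" using g(1) by blast
qed

text \<open>A fixed end would be a closed invariant singleton, and it is proper because the boundary
  has no isolated point.\<close>

lemma minimal_boundary_imp_not_parabolic:
  assumes min: "minimal_action G X \<alpha>"
  shows "\<not> parabolic G E \<phi>"
proof
  assume "parabolic G E \<phi>"
  then obtain \<omega> where w: "\<omega> \<in> ends E" "\<And>g. g \<in> carrier G \<Longrightarrow> \<alpha> g \<omega> = \<omega>"
    unfolding parabolic_def by blast
  have wt: "\<omega> \<in> topspace X" using w(1) by (simp add: topspace_boundary_topology)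
  obtain \<omega>' where "\<omega>' \<in> topspace X" "\<omega>' \<noteq> \<omega>"
    using cantor_space_perfect[OF cantor openin_topspace wt] by blast
  then have "{\<omega>} \<subset> topspace X" using wt by blast
  moreover have "closedin X {\<omega>}"
    using closedin_Hausdorff_singleton[OF cantor_space_Hausdorff[OF cantor] wt] .
  moreover have "\<forall>g\<in>carrier G. \<alpha> g ` {\<omega>} = {\<omega>}" using w(2) by simp
  ultimately show False using min unfolding minimal_action_def by (metis insert_not_empty)
qed

lemma finite_invariant_vertices_imp_invariant_measure:
  assumes min: "minimal_action G X \<alpha>" and F: "finite F" "F \<noteq> {}" "F \<subseteq> V"
    and inv: "\<And>g. g \<in> carrier G \<Longrightarrow> \<phi> g ` F \<subseteq> F"
  shows "\<exists>M. invariant_borel_probability G X \<alpha> M"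
proof -
  \<comment> \<open>The ball of radius \<open>n\<close> around \<open>F\<close>; these balls are
    finite by \<open>finite_neighbours\<close>, invariant, and exhaust the vertices.\<close>
  define B where "B n = ((\<lambda>S. S \<union> E `` S) ^^ n) F" for n
  have B0: "B 0 = F" and BS: "B (Suc n) = B n \<union> E `` B n" for n by (simp_all add: B_def)
  have BV: "B n \<subseteq> V" for n
    by (induction n) (use F(3) edge_in_V(2) in \<open>auto simp: B0 BS\<close>)
  have Bfin: "finite (B n)" for n
  proof (induction n)
    case (Suc n)
    have "E `` B n = (\<Union>v\<in>B n. {w. (v, w) \<in> E})" by blast
    then show ?case using Suc finite_neighbours[OF boundary_compact] BV[of n] by (auto simp: BS)
  qed (simp add: B0 F(1))
  have Binv: "\<phi> g v \<in> B n" if g: "g \<in> carrier G" and "v \<in> B n" for g v n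
    using that(2)
  proof (induction n arbitrary: v)
    case 0
    then show ?case using inv[OF g] by (auto simp: B0)
  next
    case (Suc n)
    then show ?case using edge_image[OF g] by (auto simp: BS)
  qed
  have Bcover: "\<exists>n. v \<in> B n" if v: "v \<in> V" for v
  proof -
    obtain u where u: "u \<in> F" using F(2) by blast
    then have "(u, v) \<in> E\<^sup>*" using connected F(3) v by blast
    then show ?thesis
    proof (induction rule: rtrancl_induct)
      case base
      show ?case using u B0 by blast
    next
      case (step y z)
      then obtain n where "y \<in> B n" by blast
      then have "z \<in> B (Suc n)" using step.hyps(2) by (auto simp: BS)
      then show ?case ..
    qed
  qed
  have Bmono: "B n \<subseteq> B m" if "n \<le> m" for n m
    using that by (induction m rule: dec_induct) (auto simp: BS)
  \<comment> \<open>Edges with both endpoints in the ball. Level 0 may be empty, as for a single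
    vertex; its only atom is then the whole boundary.\<close>
  define \<E> where "\<E> n = ends_through E ` (E \<inter> B n \<times> B n)" for n
  have "clopen_filtration G X \<alpha> \<E>"
  proof (rule clopen_filtration.intro[OF continuous_action_boundary], unfold_locales)
    show "compact_space X" by (rule boundary_compact)
    show "topspace X \<noteq> {}" using cantor by (rule cantor_space_nonempty)
    show "minimal_action G X \<alpha>" by (rule min)
    show "finite (\<E> n)" for n unfolding \<E>_def using Bfin by simp
    show "openin X A \<and> closedin X A" if A: "A \<in> \<E> n" for A n
    proof -
      obtain a b where "(a, b) \<in> E" "A = ends_through E (a, b)" using A unfolding \<E>_def by auto
      then show ?thesis using openin_ends_through closedin_ends_through by simp
    qed
    show "\<E> n \<subseteq> \<E> (Suc n)" for n unfolding \<E>_def by (auto simp: BS)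
    show "\<alpha> g ` A \<in> \<E> n" if g: "g \<in> carrier G" and A: "A \<in> \<E> n" for g A n
    proof -
      obtain a b where ab: "(a, b) \<in> E" "A = ends_through E (a, b)" "a \<in> B n" "b \<in> B n"
        using A unfolding \<E>_def by auto
      have "\<alpha> g ` A = ends_through E (\<phi> g a, \<phi> g b)" using action_ends_through[OF g ab(1)] ab(2) by simp
      moreover have "(\<phi> g a, \<phi> g b) \<in> E \<inter> B n \<times> B n" using edge_image[OF g ab(1)] Binv[OF g] ab by blast
      ultimately show ?thesis unfolding \<E>_def by blast
    qed
    fix U \<omega> assume "openin X U" "\<omega> \<in> U"
    then obtain a b where ab: "(a, b) \<in> E" "\<omega> \<in> ends_through E (a, b)" "ends_through E (a, b) \<subseteq> U"
      by (rule ends_basis)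
    obtain n m where "a \<in> B n" "b \<in> B m" using Bcover edge_in_V[OF ab(1)] by blast
    then have "a \<in> B (max n m)" "b \<in> B (max n m)" using Bmono[of n "max n m"] Bmono[of m "max n m"] by auto
    then have "ends_through E (a, b) \<in> \<E> (max n m)" unfolding \<E>_def using ab(1) by blast
    then show "\<exists>n. \<exists>A\<in>\<E> n. \<omega> \<in> A \<and> A \<subseteq> U" using ab(2,3) by blast
  qed
  then show ?thesis by (rule clopen_filtration.invariant_measure_exists)
qed

lemma minimal_boundary_imp_minimal_tree:
  assumes min: "minimal_action G X \<alpha>" and no_meas: "\<nexists>M. invariant_borel_probability G X \<alpha> M"
  shows "minimal_tree_action G V E \<phi>"
  unfolding minimal_tree_action_def
proof (rule notI, elim exE conjE)
  fix V' E'
  assume sub: "subtree V' E' V E" and ne: "(V', E') \<noteq> (V, E)"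
    and inv: "\<forall>g\<in>carrier G. \<phi> g ` V' = V' \<and> map_prod (\<phi> g) (\<phi> g) ` E' = E'"
  interpret T': tree V' E' using sub by (simp add: tree_def subtree_def)
  have V': "V' \<subseteq> V" and E': "E' \<subseteq> E" using sub by (auto simp: subtree_def)
  have in_V': "E' \<subseteq> V' \<times> V'" using T'.edge_in_V by auto
  \<comment> \<open>If an edge between vertices of the subtree were missing from \<open>E'\<close>,
    a path in \<open>E'\<close> would join its endpoints around it. Hence a proper subtree really
    misses a vertex.\<close>
  have edges: "(a, b) \<in> E'" if ab: "(a, b) \<in> E" "a \<in> V'" "b \<in> V'" for a b
  proof (rule ccontr)
    assume *: "(a, b) \<notin> E'"
    have "a \<in> half_tree E a b"
      by (rule half_tree_stay[OF T'.connected[OF ab(3,2)] E' ab(1) half_tree_self])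
        (use * T'.edge_sym in blast)
    then show False using source_notin_half_tree[OF ab(1)] by blast
  qed
  have "V' \<noteq> V"
  proof
    assume "V' = V"
    then have "E' = E" using edges edge_in_V E' by auto
    then show False using ne \<open>V' = V\<close> by blast
  qed
  then obtain y where y: "y \<in> V" "y \<notin> V'" using V' by blast
  obtain x where x: "x \<in> V'" using T'.tree by (auto simp: is_tree_def)
  define D where "D = {(a, b) \<in> E. a \<in> V' \<and> b \<notin> V'}"
  have D_ne: "D \<noteq> {}"
  proof
    assume D: "D = {}"
    have "(x, y) \<in> E\<^sup>*" using connected x y V' by blast
    then have "y \<in> V'" by (induction rule: rtrancl_induct) (use x D in \<open>auto simp: D_def\<close>)
    then show False using y by blast
  qed
  \<comment> \<open>Walks in \<open>E'\<close> never use the edge to \<open>b\<close>, so they stay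
    on the side of \<open>a\<close>.\<close>
  have avoid: "V' \<inter> half_tree E a b = {}" if ab: "(a, b) \<in> D" for a b
  proof -
    have e: "(a, b) \<in> E" "a \<in> V'" "b \<notin> V'" using ab unfolding D_def by auto
    have "v \<in> half_tree E b a" if v: "v \<in> V'" for v
      by (rule half_tree_stay[OF T'.connected[OF e(2) v] E' edge_sym[OF e(1)] half_tree_self])
        (use in_V' e(3) in blast)
    then show ?thesis using half_tree_disjoint[OF e(1)] by blast
  qed
  \<comment> \<open>The half-tree behind the second edge can meet neither side change at
    \<open>(a, b)\<close>: it starts on the side of \<open>a\<close> and does not contain
    \<open>a\<close>, so it stays on that side.\<close>
  have disj: "half_tree E a b \<inter> half_tree E a' b' = {}"
    if ab: "(a, b) \<in> D" and ab': "(a', b') \<in> D" and neq: "(a, b) \<noteq> (a', b')" for a b a' b'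
  proof -
    have e: "(a, b) \<in> E" "a \<in> V'" "b \<notin> V'" and e': "(a', b') \<in> E" "a' \<in> V'" "b' \<notin> V'"
      using ab ab' unfolding D_def by auto
    have "b' \<notin> half_tree E a b"
    proof
      assume "b' \<in> half_tree E a b"
      moreover have "a' \<notin> half_tree E a b" using avoid[OF ab] e'(2) by blast
      ultimately have "b' = b \<and> a' = a" using half_tree_exit[OF e(1) _ edge_sym[OF e'(1)]] by blast
      then show False using neq by blast
    qed
    then have "b' \<in> half_tree E b a" using half_tree_cover[OF edge_in_V(2)[OF e'(1)] e(1)] by blast
    moreover have "a \<notin> half_tree E a' b'" using avoid[OF ab'] e(2) by blast
    ultimately have "half_tree E a' b' \<subseteq> half_tree E b a"
      using half_tree_mono[OF e'(1) edge_sym[OF e(1)]] by blast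
    then show ?thesis using half_tree_disjoint[OF e(1)] by blast
  qed
  have D_inv: "(\<phi> g a, \<phi> g b) \<in> D" if g: "g \<in> carrier G" and ab: "(a, b) \<in> D" for g a b
  proof -
    have e: "(a, b) \<in> E" "a \<in> V'" "b \<notin> V'" using ab unfolding D_def by auto
    have "\<phi> g b \<notin> V'"
    proof
      assume "\<phi> g b \<in> V'"
      then have "\<phi> (inv g) (\<phi> g b) \<in> V'" using inv inv_closed[OF g] by blast
      then show False using vertex_inv(1)[OF g edge_in_V(2)[OF e(1)]] e(3) by simp
    qed
    moreover have "\<phi> g a \<in> V'" using inv g e(2) by blast
    ultimately show ?thesis using edge_image[OF g e(1)] unfolding D_def by blast
  qed
  define O' where "O' = (\<Union>e\<in>D. ends_through E e)"
  have DE: "D \<subseteq> E" unfolding D_def by blast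
  have "O' = topspace X"
  proof (rule continuous_action.minimal_action_invariant_open[OF continuous_action_boundary min])
    show "openin X O'" unfolding O'_def using openin_ends_through DE by blast
    show "O' \<noteq> {}" unfolding O'_def using D_ne DE ends_through_nonempty by fastforce
    fix g assume g: "g \<in> carrier G"
    have "\<alpha> g ` ends_through E e \<subseteq> O'" if "e \<in> D" for e
    proof -
      obtain a b where ab: "e = (a, b)" by fastforce
      then have "\<alpha> g ` ends_through E e = ends_through E (\<phi> g a, \<phi> g b)"
        using action_ends_through[OF g] that DE by blast
      then show ?thesis unfolding O'_def using D_inv[OF g] that ab by blast
    qed
    then show "\<alpha> g ` O' \<subseteq> O'" unfolding O'_def by blast
  qed
  have "finite D"
  proof (rule finite_disjoint_open_cover[OF boundary_compact, where U = "ends_through E"])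
    show "openin X (ends_through E e)" if "e \<in> D" for e using that DE openin_ends_through by blast
    show "ends_through E e \<noteq> {}" if "e \<in> D" for e
      using that DE ends_through_nonempty[of "fst e" "snd e"] by auto
    show "disjoint_family_on (ends_through E) D"
      unfolding disjoint_family_on_def
    proof (intro ballI impI)
      fix e e' assume "e \<in> D" "e' \<in> D" "e \<noteq> e'"
      then show "ends_through E e \<inter> ends_through E e' = {}"
        using ends_through_disjoint[OF disj, of "fst e" "snd e" "fst e'" "snd e'"] by simp
    qed
    show "topspace X \<subseteq> (\<Union>e\<in>D. ends_through E e)" using \<open>O' = topspace X\<close> unfolding O'_def by simp
  qed
  \<comment> \<open>The sources of the leaving edges form the finite invariant vertex set from which
    the measure is built.\<close>
  then have "finite (fst ` D)" "fst ` D \<noteq> {}" using D_ne by auto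
  moreover have "fst ` D \<subseteq> V" using DE edge_in_V(1) by fastforce
  moreover have "\<phi> g ` fst ` D \<subseteq> fst ` D" if "g \<in> carrier G" for g
  proof
    fix v assume "v \<in> \<phi> g ` fst ` D"
    then obtain a b where "(a, b) \<in> D" "v = \<phi> g a" by auto
    then show "v \<in> fst ` D" using D_inv[OF that] by force
  qed
  ultimately show False
    using finite_invariant_vertices_imp_invariant_measure[OF min] no_meas by blast
qed

end

theorem theorem6p4:
  fixes V :: "'v set" and E :: "('v \<times> 'v) set"
    and G :: "('g, 'm) monoid_scheme" and \<phi> :: "'g \<Rightarrow> 'v \<Rightarrow> 'v"
  assumes "is_tree V E" and "leafless V E"
    and "cantor_space (boundary_topology E)"
    and "tree_action G V E \<phi>"
  shows "let X = boundary_topology E; \<alpha> = boundary_action E \<phi>;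
             c1 = extremely_proximal G X \<alpha>;
             c2 = extremely_proximal (topological_full_group G X \<alpha>) X (\<lambda>h. h);
             c3 = (minimal_action G X \<alpha> \<and> (\<nexists>M. invariant_borel_probability G X \<alpha> M));
             c4 = (minimal_tree_action G V E \<phi> \<and> \<not> parabolic G E \<phi>)
         in (c1 \<longleftrightarrow> c2) \<and> (c2 \<longleftrightarrow> c3) \<and> (c3 \<longleftrightarrow> c4)"
proof -
  interpret T: cantor_tree_action V E G \<phi>
    using assms unfolding tree_action_def cantor_tree_action_def cantor_tree_action_axioms_def
      leafless_tree_action_def leafless_tree_action_axioms_def leafless_tree_def leafless_tree_axioms_def tree_def
    by auto
  interpret C: clopen_action G "boundary_topology E" "boundary_action E \<phi>"
    by (rule T.clopen_action_boundary)
  show ?thesis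
    unfolding Let_def
    using C.extremely_proximal_topological_full_group C.full_group_proximal_imp_minimal
      C.full_group_proximal_imp_no_measure T.minimal_boundary_imp_not_parabolic
      T.minimal_boundary_imp_minimal_tree T.minimal_nonparabolic_imp_extremely_proximal
    by argo
qed

end
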